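(* Let $k$ be any field of characteristic $p\neq 2$, and let $G_0$ be the infinite dimensional nonunitary Grassmann algebra over $k$. Then $CP(G_0)=S+T(G_0)$.
   Context: $X=\{x_i\mid i\ge 1\}$ is a countably infinite set, and $k_0\langle X\rangle$ is the free nonunitary associative $k$-algebra over $X$. $[u,v]=uv-vu$. A $T$-space of a $k$-algebra $A$ is a linear subspace of $A$ invariant under every endomorphism of $A$; for $Y\subseteq A$, $Y^S$ is the smallest $T$-space of $A$ containing $Y$. Here $T$-spaces are taken in $A=k_0\langle X\rangle$. The unitary Grassmann algebra $G$ over $k$ is the unital associative algebra generated by $e_i$, $i\ge1$, with $e_ie_j=-e_je_i$ and $e_i^2=0$ for all $i,j$, and with linear basis $\{1\}\cup\mathcal B$, where $\mathcal B=\{e_{i_1}e_{i_2}\cdots e_{i_n}\mid n\ge 1,\ i_1<i_2<\cdots<i_n\}$. $G_0$ is the (nonunitary) subalgebra of $G$ with linear basis $\mathcal B$. $T(G_0)\subseteq k_0\langle X\rangle$ is the set of identities of $G_0$, i.e. the elements lying in the kernel of every homomorphism $k_0\langle X\rangle\to G_0$. A central polynomial of $G_0$ is an element $f\in k_0\langle X\rangle$ with $f\notin T(G_0)$ whose image under every homomorphism $k_0\langle X\rangle\to G_0$ lies in the centre of $G_0$. $CP(G_0)$ is the $T$-space of $k_0\langle X\rangle$ generated by the central polynomials of $G_0$. Definition of $S$: if $p=0$, $S=\{[x_1,x_2]\}^S$; if $p>2$, $S=\{[x_1,x_2]\}^S+\{w_n\mid n\ge1\}^S$, where $w_n=\prod_{k=1}^n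 [x_{2k-1},x_{2k}]x_{2k-1}^{p-1}x_{2k}^{p-1}$. *)

theory Defs
  imports Complex_Main "HOL-Library.Poly_Mapping" "HOL-Library.FSet" "HOL-Library.Set_Algebras"
begin

section \<open>Subalgebras, homomorphisms and T-spaces\<close>

text \<open>
  The algebras under consideration are subsets \<open>A\<close> of an ambient ring type whose scalar
  multiplication is passed explicitly.  Homomorphisms are not required to preserve a unit, and
  only their values on \<open>A\<close> matter.
\<close>

definition subalgebra :: "('k::field \<Rightarrow> 'a::ring \<Rightarrow> 'a) \<Rightarrow> 'a set \<Rightarrow> bool" where
  "subalgebra s A \<longleftrightarrow> module.subspace s A \<and> (\<forall>x\<in>A. \<forall>y\<in>A. x * y \<in> A)"

definition algebra_hom ::
  "('k::field \<Rightarrow> 'a::ring \<Rightarrow> 'a) \<Rightarrow> ('k \<Rightarrow> 'b::ring \<Rightarrow> 'b) \<Rightarrow> 'a set \<Rightarrow> 'b set \<Rightarrow> ('a \<Rightarrow> 'b) \<Rightarrow> bool"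
  where
  "algebra_hom s t A B \<phi> \<longleftrightarrow>
     (\<forall>x\<in>A. \<phi> x \<in> B) \<and>
     (\<forall>x\<in>A. \<forall>y\<in>A. \<phi> (x + y) = \<phi> x + \<phi> y) \<and>
     (\<forall>c. \<forall>x\<in>A. \<phi> (s c x) = t c (\<phi> x)) \<and>
     (\<forall>x\<in>A. \<forall>y\<in>A. \<phi> (x * y) = \<phi> x * \<phi> y)"

definition T_space :: "('k::field \<Rightarrow> 'a::ring \<Rightarrow> 'a) \<Rightarrow> 'a set \<Rightarrow> 'a set \<Rightarrow> bool" where
  "T_space s A V \<longleftrightarrow> module.subspace s V \<and> V \<subseteq> A \<and>
     (\<forall>\<phi>. algebra_hom s s A A \<phi> \<longrightarrow> \<phi> ` V \<subseteq> V)"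

definition T_space_gen :: "('k::field \<Rightarrow> 'a::ring \<Rightarrow> 'a) \<Rightarrow> 'a set \<Rightarrow> 'a set \<Rightarrow> 'a set" where
  "T_space_gen s A Y = \<Inter>{V. T_space s A V \<and> Y \<subseteq> V}"

definition center_of :: "'a::ring set \<Rightarrow> 'a set" where
  "center_of A = {z \<in> A. \<forall>a\<in>A. z * a = a * z}"

definition commutator :: "'a::ring \<Rightarrow> 'a \<Rightarrow> 'a" where
  "commutator u v = u * v - v * u"

lemma T_space_T_space_gen:
  assumes "module s" "subalgebra s A" "Y \<subseteq> A"
  shows "T_space s A (T_space_gen s A Y)"
proof -
  interpret module s by fact
  have "T_space s A A"
    using assms(2) unfolding T_space_def subalgebra_def algebra_hom_def image_subset_iff by simp
  then have ne: "T_space_gen s A Y \<subseteq> A"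
    using assms(3) unfolding T_space_gen_def by blast
  have sub: "subspace (T_space_gen s A Y)"
    unfolding T_space_gen_def
    by (rule subspace_Inter) (simp add: T_space_def)
  have "\<phi> x \<in> T_space_gen s A Y" if hom: "algebra_hom s s A A \<phi>" and x: "x \<in> T_space_gen s A Y" for \<phi> x
    unfolding T_space_gen_def
  proof (rule InterI)
    fix V assume V: "V \<in> {V. T_space s A V \<and> Y \<subseteq> V}"
    then have "x \<in> V" using x unfolding T_space_gen_def by blast
    moreover have "\<phi> ` V \<subseteq> V" using V hom unfolding T_space_def by blast
    ultimately show "\<phi> x \<in> V" by blast
  qed
  with ne sub show ?thesis unfolding T_space_def by blast
qed


section \<open>The free associative algebra\<close>

lemma pm_induct [case_names zero single add]:
  assumes "P 0" "\<And>A a. P (Poly_Mapping.single A a)" "\<And>f g. P f \<Longrightarrow> P g \<Longrightarrow> P (f + g)"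
  shows "P (f :: 'a \<Rightarrow>\<^sub>0 'b::comm_monoid_add)"
proof -
  have "f = (\<Sum>A\<in>Poly_Mapping.keys f. Poly_Mapping.single A (Poly_Mapping.lookup f A))"
    by (rule poly_mapping_eqI)
      (auto simp: lookup_sum lookup_single when_def in_keys_iff)
  moreover have "P (\<Sum>A\<in>X. Poly_Mapping.single A (Poly_Mapping.lookup f A))" if "finite X" for X
    using that by (induction X) (auto intro: assms)
  ultimately show ?thesis by (metis finite_keys)
qed

text \<open>
  The unitary free algebra is the monoid algebra of the free monoid of words.  The monoid is
  written additively because that is how \<^typ>\<open>'a \<Rightarrow>\<^sub>0 'b\<close> forms its convolution product.
\<close>

datatype 'x word = Word (letters: "'x list")

instantiation word :: (type) monoid_add
begin

definition zero_word :: "'a word" where "zero_word = Word []"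
definition plus_word :: "'a word \<Rightarrow> 'a word \<Rightarrow> 'a word"
  where "plus_word u v = Word (letters u @ letters v)"

instance by standard (simp_all add: zero_word_def plus_word_def)

end

text \<open>The countably infinite set of variables is indexed by all of \<^typ>\<open>nat\<close>.\<close>

type_synonym 'k free_alg = "nat word \<Rightarrow>\<^sub>0 'k"

definition free_scale :: "'k::field \<Rightarrow> 'k free_alg \<Rightarrow> 'k free_alg" where
  "free_scale c f = Poly_Mapping.map ((*) c) f"

definition var :: "nat \<Rightarrow> 'k::field free_alg" where
  "var i = Poly_Mapping.single (Word [i]) 1"

text \<open>The nonunitary free algebra: no constant term.\<close>

definition free_alg0 :: "'k::field free_alg set" where
  "free_alg0 = {f. Poly_Mapping.lookup f (Word []) = 0}"

lemma lookup_free_scale [simp]: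
  "Poly_Mapping.lookup (free_scale c f) w = c * Poly_Mapping.lookup f w"
  by (simp add: free_scale_def map.rep_eq when_def)

interpretation free_vs: vector_space free_scale
  by standard (auto intro!: poly_mapping_eqI simp: lookup_add algebra_simps)

lemma free_scale_mult:
  "free_scale c (f * g) = free_scale c f * g" "free_scale c (f * g) = f * free_scale c g"
proof -
  have sc: "free_scale c h = Poly_Mapping.single 0 c * h" for h :: "'a free_alg"
    by (simp add: free_scale_def mult_map_scale_conv_mult)
  have comm: "f * Poly_Mapping.single 0 c = Poly_Mapping.single 0 c * f"
    by (induction f rule: pm_induct) (simp_all add: distrib_left distrib_right mult_single mult.commute)
  show "free_scale c (f * g) = free_scale c f * g" by (simp add: sc mult.assoc)
  show "free_scale c (f * g) = f * free_scale c g"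
    by (simp add: sc mult.assoc[symmetric] comm)
qed

lemma subalgebra_free_alg0: "subalgebra free_scale (free_alg0 :: 'k::field free_alg set)"
proof -
  have "Poly_Mapping.lookup (f * g) (Word []) = 0" if "f \<in> free_alg0" "g \<in> free_alg0"
    for f g :: "'k free_alg"
  proof (rule ccontr)
    assume "Poly_Mapping.lookup (f * g) (Word []) \<noteq> 0"
    then obtain u v where "Word [] = u + v" "u \<in> Poly_Mapping.keys f"
      using keys_mult[of f g] by (fastforce simp: in_keys_iff)
    moreover from this have "u = Word []"
      by (cases u) (simp add: plus_word_def)
    ultimately show False using that by (simp add: free_alg0_def in_keys_iff)
  qed
  then show ?thesis
    by (auto simp: subalgebra_def free_vs.subspace_def free_alg0_def lookup_add)
qed


section \<open>The Grassmann algebra\<close>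

text \<open>
  The basis element indexed by a finite set \<open>A\<close> is the product of the generators \<open>e\<^sub>i\<close>,
  \<open>i \<in> A\<close>, in increasing order.  Sorting a product of two basis elements gives
  \<open>e\<^sub>A e\<^sub>B = \<plusminus> e\<^bsub>A \<union> B\<^esub>\<close> if \<open>A\<close> and \<open>B\<close> are disjoint (the sign being that of
  the number of inversions) and \<open>0\<close> otherwise.
\<close>

typedef (overloaded) 'k grassmann = "UNIV :: (nat fset \<Rightarrow>\<^sub>0 'k::field) set"
  morphisms gr_coeffs Gr by simp

setup_lifting type_definition_grassmann

definition inversions :: "nat fset \<Rightarrow> nat fset \<Rightarrow> nat" where
  "inversions A B = card {(i, j). i |\<in>| A \<and> j |\<in>| B \<and> j < i}"

definition gr_sign :: "nat fset \<Rightarrow> nat fset \<Rightarrow> 'k::field" where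
  "gr_sign A B = (if A |\<inter>| B = {||} then (- 1) ^ inversions A B else 0)"

definition gr_mult :: "(nat fset \<Rightarrow>\<^sub>0 'k::field) \<Rightarrow> (nat fset \<Rightarrow>\<^sub>0 'k) \<Rightarrow> (nat fset \<Rightarrow>\<^sub>0 'k)" where
  "gr_mult f g = (\<Sum>A\<in>Poly_Mapping.keys f. \<Sum>B\<in>Poly_Mapping.keys g.
     Poly_Mapping.single (A |\<union>| B)
       (gr_sign A B * (Poly_Mapping.lookup f A * Poly_Mapping.lookup g B)))"

lemma gr_mult_superset:
  assumes "finite X" "finite Y" "Poly_Mapping.keys f \<subseteq> X" "Poly_Mapping.keys g \<subseteq> Y"
  shows "gr_mult f g = (\<Sum>A\<in>X. \<Sum>B\<in>Y. Poly_Mapping.single (A |\<union>| B)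
       (gr_sign A B * (Poly_Mapping.lookup f A * Poly_Mapping.lookup g B)))"
proof -
  have "gr_mult f g = (\<Sum>A\<in>Poly_Mapping.keys f. \<Sum>B\<in>Y. Poly_Mapping.single (A |\<union>| B)
       (gr_sign A B * (Poly_Mapping.lookup f A * Poly_Mapping.lookup g B)))"
    unfolding gr_mult_def
    by (intro sum.cong refl sum.mono_neutral_left) (use assms in \<open>auto simp: in_keys_iff\<close>)
  also have "\<dots> = (\<Sum>A\<in>X. \<Sum>B\<in>Y. Poly_Mapping.single (A |\<union>| B)
       (gr_sign A B * (Poly_Mapping.lookup f A * Poly_Mapping.lookup g B)))"
    by (intro sum.mono_neutral_left) (use assms in \<open>auto simp: in_keys_iff\<close>)
  finally show ?thesis .
qed

lemma gr_mult_add_left: "gr_mult (f + f') g = gr_mult f g + gr_mult f' g"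
proof -
  let ?X = "Poly_Mapping.keys f \<union> Poly_Mapping.keys f'" and ?Y = "Poly_Mapping.keys g"
  show ?thesis
    using keys_add[of f f']
    by (simp add: gr_mult_superset[of ?X ?Y] lookup_add distrib_left distrib_right
        single_add sum.distrib)
qed

lemma gr_mult_add_right: "gr_mult f (g + g') = gr_mult f g + gr_mult f g'"
proof -
  let ?Y = "Poly_Mapping.keys g \<union> Poly_Mapping.keys g'" and ?X = "Poly_Mapping.keys f"
  show ?thesis
    using keys_add[of g g']
    by (simp add: gr_mult_superset[of ?X ?Y] lookup_add distrib_left distrib_right
        single_add sum.distrib)
qed

lemma gr_mult_zero [simp]: "gr_mult 0 g = 0" "gr_mult f 0 = 0"
  by (simp_all add: gr_mult_def)

lemma gr_mult_single:
  "gr_mult (Poly_Mapping.single A a) (Poly_Mapping.single B b) =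
   Poly_Mapping.single (A |\<union>| B) (gr_sign A B * (a * b))"
  by (subst gr_mult_superset[of "{A}" "{B}"]) auto

lemma inversions_union_left:
  assumes "A |\<inter>| B = {||}"
  shows "inversions (A |\<union>| B) C = inversions A C + inversions B C"
proof -
  have fin: "finite {(i, j). i |\<in>| D \<and> j |\<in>| C \<and> j < i}" for D
    by (rule finite_subset[of _ "fset D \<times> fset C"]) auto
  have "{(i, j). i |\<in>| A |\<union>| B \<and> j |\<in>| C \<and> j < i} =
     {(i, j). i |\<in>| A \<and> j |\<in>| C \<and> j < i} \<union> {(i, j). i |\<in>| B \<and> j |\<in>| C \<and> j < i}" by auto
  then show ?thesis unfolding inversions_def
    using assms by (simp, subst card_Un_disjoint) (auto intro: fin)
qed

lemma inversions_union_right: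
  assumes "B |\<inter>| C = {||}"
  shows "inversions A (B |\<union>| C) = inversions A B + inversions A C"
proof -
  have fin: "finite {(i, j). i |\<in>| A \<and> j |\<in>| D \<and> j < i}" for D
    by (rule finite_subset[of _ "fset A \<times> fset D"]) auto
  have "{(i, j). i |\<in>| A \<and> j |\<in>| B |\<union>| C \<and> j < i} =
     {(i, j). i |\<in>| A \<and> j |\<in>| B \<and> j < i} \<union> {(i, j). i |\<in>| A \<and> j |\<in>| C \<and> j < i}" by auto
  then show ?thesis unfolding inversions_def
    using assms by (simp, subst card_Un_disjoint) (auto intro: fin)
qed

lemma gr_sign_cocycle:
  "gr_sign A B * gr_sign (A |\<union>| B) C = (gr_sign B C * gr_sign A (B |\<union>| C) :: 'k::field)"
  by (auto simp: gr_sign_def inversions_union_left inversions_union_right power_add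
      inf_sup_distrib1 inf_sup_distrib2)

lemma gr_sign_empty [simp]: "gr_sign {||} A = 1" "gr_sign A {||} = 1"
  by (simp_all add: gr_sign_def inversions_def)

lemma gr_mult_assoc: "gr_mult (gr_mult f g) h = gr_mult f (gr_mult g h)"
proof (induction f rule: pm_induct)
  case (single A a)
  show ?case
  proof (induction g rule: pm_induct)
    case (single B b)
    show ?case
    proof (induction h rule: pm_induct)
      case (single C c)
      show ?case
        using gr_sign_cocycle[of A B C, where 'k = 'a]
        by (simp add: gr_mult_single sup_assoc mult_ac)
    qed (simp_all add: gr_mult_add_left gr_mult_add_right)
  qed (simp_all add: gr_mult_add_left gr_mult_add_right)
qed (simp_all add: gr_mult_add_left gr_mult_add_right)

lemma gr_mult_one:
  "gr_mult (Poly_Mapping.single {||} 1) f = f" "gr_mult f (Poly_Mapping.single {||} 1) = f"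
  by (induction f rule: pm_induct)
    (simp_all add: gr_mult_add_left gr_mult_add_right gr_mult_single)

instantiation grassmann :: (field) ring_1
begin

lift_definition zero_grassmann :: "'a grassmann" is 0 .
lift_definition one_grassmann :: "'a grassmann" is "Poly_Mapping.single {||} 1" .
lift_definition plus_grassmann :: "'a grassmann \<Rightarrow> 'a grassmann \<Rightarrow> 'a grassmann" is "(+)" .
lift_definition minus_grassmann :: "'a grassmann \<Rightarrow> 'a grassmann \<Rightarrow> 'a grassmann" is "(-)" .
lift_definition uminus_grassmann :: "'a grassmann \<Rightarrow> 'a grassmann" is uminus .
lift_definition times_grassmann :: "'a grassmann \<Rightarrow> 'a grassmann \<Rightarrow> 'a grassmann" is gr_mult .

instance
proof
  fix a b c :: "'a grassmann"
  show "a + b + c = a + (b + c)" by transfer (simp add: add.assoc)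
  show "a + b = b + a" by transfer (simp add: add.commute)
  show "0 + a = a" by transfer simp
  show "- a + a = 0" by transfer simp
  show "a - b = a + - b" by transfer simp
  show "a * b * c = a * (b * c)" by transfer (rule gr_mult_assoc)
  show "(a + b) * c = a * c + b * c" by transfer (rule gr_mult_add_left)
  show "a * (b + c) = a * b + a * c" by transfer (rule gr_mult_add_right)
  show "1 * a = a" by transfer (rule gr_mult_one)
  show "a * 1 = a" by transfer (rule gr_mult_one)
  show "(0 :: 'a grassmann) \<noteq> 1"
    by transfer (metis lookup_single_eq lookup_zero zero_neq_one)
qed

end

lift_definition gr_scale :: "'k::field \<Rightarrow> 'k grassmann \<Rightarrow> 'k grassmann"
  is "\<lambda>c f. Poly_Mapping.map ((*) c) f" .

lift_definition gr_basis :: "nat fset \<Rightarrow> 'k::field grassmann"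
  is "\<lambda>A. Poly_Mapping.single A 1" .

definition gr_gen :: "nat \<Rightarrow> 'k::field grassmann" where
  "gr_gen i = gr_basis {|i|}"

text \<open>The nonunitary Grassmann algebra: no component along the unit.\<close>

definition grassmann0 :: "'k::field grassmann set" where
  "grassmann0 = {g. Poly_Mapping.lookup (gr_coeffs g) {||} = 0}"

lemma lookup_gr_scale [simp]:
  "Poly_Mapping.lookup (gr_coeffs (gr_scale c f)) A = c * Poly_Mapping.lookup (gr_coeffs f) A"
  by transfer (simp add: map.rep_eq when_def)

lemma lookup_gr_add:
  "Poly_Mapping.lookup (gr_coeffs (x + y)) A =
   Poly_Mapping.lookup (gr_coeffs x) A + Poly_Mapping.lookup (gr_coeffs y) A"
  by transfer (simp add: lookup_add)

lemma gr_eqI: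
  "(\<And>A. Poly_Mapping.lookup (gr_coeffs x) A = Poly_Mapping.lookup (gr_coeffs y) A) \<Longrightarrow> x = y"
  by transfer (rule poly_mapping_eqI)

interpretation gr_vs: vector_space gr_scale
  by standard (auto intro!: gr_eqI simp: lookup_gr_add algebra_simps)

lemma gr_scale_mult:
  "gr_scale c (f * g) = gr_scale c f * g" "gr_scale c (f * g) = f * gr_scale c g"
proof -
  define m where "m = (\<lambda>h :: nat fset \<Rightarrow>\<^sub>0 'a. Poly_Mapping.map ((*) c) h)"
  have lookup_m: "Poly_Mapping.lookup (m h) A = c * Poly_Mapping.lookup h A" for h A
    by (simp add: m_def map.rep_eq when_def)
  have add: "m (f + g) = m f + m g" for f g
    by (rule poly_mapping_eqI) (simp add: lookup_m lookup_add distrib_left)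
  have zero: "m 0 = 0"
    by (rule poly_mapping_eqI) (simp add: lookup_m)
  have m_single: "m (Poly_Mapping.single A a) = Poly_Mapping.single A (c * a)" for A a
    by (rule poly_mapping_eqI) (simp add: lookup_m lookup_single when_def)
  have "m (gr_mult f g) = gr_mult (m f) g" "m (gr_mult f g) = gr_mult f (m g)" for f g
  proof (induction f rule: pm_induct)
    case (single A a)
    {
      case 1
      show ?case
        by (induction g rule: pm_induct)
          (simp_all add: add zero m_single gr_mult_add_right gr_mult_single mult_ac)
    next
      case 2
      show ?case
        by (induction g rule: pm_induct)
          (simp_all add: add zero m_single gr_mult_add_right gr_mult_single mult_ac)
    }
  qed (simp_all add: add zero gr_mult_add_left)
  then have *: "Poly_Mapping.map ((*) c) (gr_mult f g) = gr_mult (Poly_Mapping.map ((*) c) f) g"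
     "Poly_Mapping.map ((*) c) (gr_mult f g) = gr_mult f (Poly_Mapping.map ((*) c) g)" for f g
    by (auto simp: m_def)
  show "gr_scale c (f * g) = gr_scale c f * g" by (transfer fixing: c) (rule *)
  show "gr_scale c (f * g) = f * gr_scale c g" by (transfer fixing: c) (rule *)
qed

lemma gr_basis_mult:
  "gr_basis A * gr_basis B = gr_scale (gr_sign A B) (gr_basis (A |\<union>| B) :: 'k::field grassmann)"
  by transfer (simp add: gr_mult_single)

lemma gr_basis_empty: "gr_basis {||} = 1"
  by transfer simp

lemma inversions_singletons: "inversions {|i|} {|j|} = (if j < i then 1 else 0)"
proof -
  have "{(a, b). a |\<in>| {|i|} \<and> b |\<in>| {|j|} \<and> b < a} = (if j < i then {(i, j)} else {})" by auto
  then show ?thesis by (simp add: inversions_def)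
qed

lemma gr_gen_anticommute: "gr_gen i * gr_gen j = - (gr_gen j * gr_gen i :: 'k::field grassmann)"
proof -
  have "(gr_sign {|i|} {|j|} :: 'k) = - gr_sign {|j|} {|i|}"
    by (auto simp: gr_sign_def inversions_singletons)
  then show ?thesis
    by (simp add: gr_gen_def gr_basis_mult sup_commute gr_vs.scale_minus_left)
qed

lemma gr_gen_square: "gr_gen i * gr_gen i = (0 :: 'k::field grassmann)"
  by (simp add: gr_gen_def gr_basis_mult gr_sign_def)

lemma gr_basis_eq_prod: "gr_basis A = prod_list (map gr_gen (sorted_list_of_fset A))"
proof -
  have *: "gr_basis (fset_of_list xs) = (prod_list (map gr_gen xs) :: 'a grassmann)"
    if "sorted_wrt (<) xs" for xs
    using that
  proof (induction xs)
    case (Cons x xs)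
    have "(gr_sign {|x|} (fset_of_list xs) :: 'a) = 1"
    proof -
      have "{(i, j). i |\<in>| {|x|} \<and> j |\<in>| fset_of_list xs \<and> j < i} = {}"
        using Cons.prems by (auto simp: fset_of_list_elem)
      then have "inversions {|x|} (fset_of_list xs) = 0" by (simp only: inversions_def card.empty)
      moreover have "{|x|} |\<inter>| fset_of_list xs = {||}"
        using Cons.prems by (auto simp: fset_of_list_elem)
      ultimately show ?thesis by (simp only: gr_sign_def if_True power_0 refl)
    qed
    then have "gr_gen x * gr_basis (fset_of_list xs) =
        (gr_basis (fset_of_list (x # xs)) :: 'a grassmann)"
      by (simp add: gr_gen_def gr_basis_mult)
    with Cons show ?case by simp
  qed (simp add: gr_basis_empty)
  have "fset_of_list (sorted_list_of_fset A) = A"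
    by (rule iffD1[OF fset_inject]) (simp add: fset_of_list.rep_eq sorted_list_of_fset.rep_eq)
  then show ?thesis
    using *[of "sorted_list_of_fset A"]
    by (simp add: sorted_list_of_fset.rep_eq)
qed

lemma lookup_gr_basis:
  "Poly_Mapping.lookup (gr_coeffs (gr_basis A)) B = (if A = B then 1 else 0)"
  by transfer (simp add: lookup_single when_def)

lemma lookup_gr_zero: "Poly_Mapping.lookup (gr_coeffs 0) A = 0"
  by transfer simp

lemma lookup_gr_sum:
  "Poly_Mapping.lookup (gr_coeffs (sum f X)) A = (\<Sum>x\<in>X. Poly_Mapping.lookup (gr_coeffs (f x)) A)"
  by (induction X rule: infinite_finite_induct) (simp_all add: lookup_gr_add lookup_gr_zero)

lemma gr_basis_expansion:
  "x = (\<Sum>A\<in>Poly_Mapping.keys (gr_coeffs x).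
      gr_scale (Poly_Mapping.lookup (gr_coeffs x) A) (gr_basis A))"
  by (rule gr_eqI) (simp add: lookup_gr_sum lookup_gr_basis in_keys_iff if_distrib cong: if_cong)

lemma inj_gr_basis: "inj (gr_basis :: nat fset \<Rightarrow> 'k::field grassmann)"
  by (rule injI) (metis lookup_gr_basis zero_neq_one)

lemma gr_basis_span: "gr_vs.span (range gr_basis) = (UNIV :: 'k::field grassmann set)"
proof -
  have "x \<in> gr_vs.span (range gr_basis)" for x :: "'k grassmann"
    by (subst gr_basis_expansion)
      (intro gr_vs.span_sum gr_vs.span_scale gr_vs.span_base rangeI)
  then show ?thesis by auto
qed

lemma gr_basis_independent: "gr_vs.independent (range gr_basis :: 'k::field grassmann set)"
proof -
  have "u v = 0" if t: "finite t" "t \<subseteq> range gr_basis" "(\<Sum>v\<in>t. gr_scale (u v) v) = 0" "v \<in> t"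
    for t and u :: "'k grassmann \<Rightarrow> 'k" and v
  proof -
    obtain A where v: "v = gr_basis A" using t by auto
    have "0 = Poly_Mapping.lookup (gr_coeffs (\<Sum>v\<in>t. gr_scale (u v) v)) A"
      by (simp only: t(3) lookup_gr_zero)
    also have "\<dots> = (\<Sum>w\<in>t. if w = v then u v else 0)"
      unfolding lookup_gr_sum
    proof (rule sum.cong)
      fix w assume "w \<in> t"
      then obtain B where "w = gr_basis B" using t(2) by auto
      then show "Poly_Mapping.lookup (gr_coeffs (gr_scale (u w) w)) A = (if w = v then u v else 0)"
        by (simp add: v lookup_gr_basis inj_eq[OF inj_gr_basis])
    qed simp
    also have "\<dots> = u v" using t by simp
    finally show ?thesis by simp
  qed
  then show ?thesis unfolding gr_vs.dependent_explicit by blast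
qed

lemma subalgebra_grassmann0: "subalgebra gr_scale (grassmann0 :: 'k::field grassmann set)"
proof -
  have eps: "Poly_Mapping.lookup (gr_mult f g) {||} =
      Poly_Mapping.lookup f {||} * Poly_Mapping.lookup g {||}" for f g :: "nat fset \<Rightarrow>\<^sub>0 'k"
  proof (induction f rule: pm_induct)
    case (single A a)
    show ?case
      by (induction g rule: pm_induct)
        (auto simp: gr_mult_add_right gr_mult_single lookup_add lookup_single when_def distrib_left)
  qed (simp_all add: gr_mult_add_left lookup_add distrib_right)
  have "Poly_Mapping.lookup (gr_coeffs (x * y)) {||} =
      Poly_Mapping.lookup (gr_coeffs x) {||} * Poly_Mapping.lookup (gr_coeffs y) {||}"
    for x y :: "'k grassmann" by transfer (rule eps)
  then show ?thesis
    by (simp add: subalgebra_def gr_vs.subspace_def grassmann0_def lookup_gr_add lookup_gr_zero)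
qed

lemma grassmann0_span:
  "(grassmann0 :: 'k::field grassmann set) = gr_vs.span (gr_basis ` {A. A \<noteq> {||}})"
proof
  show "grassmann0 \<subseteq> gr_vs.span (gr_basis ` {A. A \<noteq> {||}} :: 'k grassmann set)"
  proof
    fix x :: "'k grassmann"
    assume "x \<in> grassmann0"
    then have "A \<noteq> {||}" if "A \<in> Poly_Mapping.keys (gr_coeffs x)" for A
      using that by (auto simp: grassmann0_def in_keys_iff)
    then show "x \<in> gr_vs.span (gr_basis ` {A. A \<noteq> {||}})"
      by (subst gr_basis_expansion)
        (intro gr_vs.span_sum gr_vs.span_scale gr_vs.span_base imageI CollectI)
  qed
  have "gr_vs.subspace (grassmann0 :: 'k grassmann set)"
    using subalgebra_grassmann0 unfolding subalgebra_def by blast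
  then show "gr_vs.span (gr_basis ` {A. A \<noteq> {||}}) \<subseteq> (grassmann0 :: 'k grassmann set)"
    by (rule gr_vs.span_minimal[rotated]) (simp add: grassmann0_def lookup_gr_basis image_subset_iff)
qed


section \<open>Identities and central polynomials of the nonunitary Grassmann algebra\<close>

definition identities_G0 :: "'k::field free_alg set" where
  "identities_G0 = {f \<in> free_alg0.
     \<forall>\<phi>. algebra_hom free_scale gr_scale free_alg0 grassmann0 \<phi> \<longrightarrow> \<phi> f = 0}"

definition central_poly_G0 :: "'k::field free_alg \<Rightarrow> bool" where
  "central_poly_G0 f \<longleftrightarrow> f \<in> free_alg0 \<and> f \<notin> identities_G0 \<and>
     (\<forall>\<phi>. algebra_hom free_scale gr_scale free_alg0 grassmann0 \<phi> \<longrightarrow> \<phi> f \<in> center_of grassmann0)"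

definition CP_G0 :: "'k::field free_alg set" where
  "CP_G0 = T_space_gen free_scale free_alg0 {f. central_poly_G0 f}"

definition w_poly :: "nat \<Rightarrow> 'k::field free_alg" where
  "w_poly n = prod_list (map
     (\<lambda>k. commutator (var (2 * k - 1)) (var (2 * k)) *
          var (2 * k - 1) ^ (CHAR('k) - 1) * var (2 * k) ^ (CHAR('k) - 1))
     [1..<Suc n])"

text \<open>Only used for characteristic different from \<open>2\<close>.\<close>

definition S_space :: "'k::field free_alg set" where
  "S_space =
     (if CHAR('k) = 0 then T_space_gen free_scale free_alg0 {commutator (var 1) (var 2)}
      else T_space_gen free_scale free_alg0 {commutator (var 1) (var 2)} +
           T_space_gen free_scale free_alg0 {w_poly n | n. n \<ge> 1})"

end

theory Submission
  imports Defs
begin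

text \<open>
  The centre of \<open>G\<^sub>0\<close> is its even part, so \<open>CP(G\<^sub>0)\<close> is the set of polynomials all of whose
  values on \<open>G\<^sub>0\<close> are even; let \<open>f\<close> be one of them.  Modulo commutators, multiplying every word
  of \<open>f\<close> by its degree in \<open>x\<^sub>i\<close> gives \<open>x\<^sub>i D\<^sub>i f\<close>, where \<open>D\<^sub>i f\<close> is the cyclic derivative.
  For a basis monomial \<open>b\<close>, the difference \<open>f(\<dots>, g\<^sub>i + b, \<dots>) - f(\<dots>, g\<^sub>i, \<dots>)\<close> is linear in
  \<open>b\<close>, because \<open>b x b = 0\<close>, and equals \<open>b D\<^sub>i f(g)\<close> up to a commutator.  Hence \<open>b D\<^sub>i f(g)\<close> is even
  for every \<open>b\<close>, which forces \<open>D\<^sub>i f(g) = 0\<close>.  So each degree operator maps \<open>f\<close> into the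
  commutators plus the identities, and all words having some degree that is nonzero in \<open>k\<close> can be
  removed from \<open>f\<close>.  This argument works over finite fields as well.

  In characteristic \<open>0\<close> nothing remains.  In characteristic \<open>p\<close>, write \<open>g\<^sub>i = u\<^sub>i + \<theta>\<^sub>i\<close> with
  \<open>u\<^sub>i\<close> even and \<open>\<theta>\<^sub>i\<close> odd.  Since \<open>u\<^sub>i\<^sup>p = 0\<close> and \<open>\<theta>\<^sub>i\<^sup>2 = 0\<close>, a word all of whose degrees are divisible
  by \<open>p\<close> takes the value \<open>c \<Prod> \<theta>\<^sub>i u\<^sub>i\<^bsup>p-1\<^esup>\<close>, the product running over its variables.  If there are
  \<open>2n\<close> variables this is a multiple of a value of \<open>w\<^sub>n\<close>; if their number is odd the value is odd,
  and therefore the sum of all such words is an identity.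
\<close>

section \<open>Parity in the Grassmann algebra\<close>

abbreviation gr_coeff :: "'k::field grassmann \<Rightarrow> nat fset \<Rightarrow> 'k" where
  "gr_coeff x \<equiv> Poly_Mapping.lookup (gr_coeffs x)"

text \<open>\<open>True\<close> stands for even and \<open>False\<close> for odd. Zero has both
  parities, so each parity class is a subspace.\<close>

definition gr_parity :: "bool \<Rightarrow> 'k::field grassmann \<Rightarrow> bool" where
  "gr_parity b x \<longleftrightarrow> (\<forall>A. gr_coeff x A \<noteq> 0 \<longrightarrow> even (fcard A) = b)"

definition gr_part :: "bool \<Rightarrow> 'k::field grassmann \<Rightarrow> 'k grassmann" where
  "gr_part b x = (\<Sum>A | A \<in> Poly_Mapping.keys (gr_coeffs x) \<and> even (fcard A) = b.
      gr_scale (gr_coeff x A) (gr_basis A))"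

text \<open>Induction over the basis expansion of x, so only sets in the support of x are met;
  \<open>Q\<close> carries a property of these sets, such as a parity, into the case of a single
  term.\<close>

lemma gr_support_induct [case_names supp zero single add]:
  assumes "\<And>A. gr_coeff x A \<noteq> 0 \<Longrightarrow> Q A"
    and "P 0" "\<And>A c. Q A \<Longrightarrow> P (gr_scale c (gr_basis A))"
    and "\<And>x y. P x \<Longrightarrow> P y \<Longrightarrow> P (x + y)"
  shows "P (x :: 'k::field grassmann)"
proof -
  have "P (\<Sum>A\<in>X. gr_scale (gr_coeff x A) (gr_basis A))"
    if "finite X" "X \<subseteq> Poly_Mapping.keys (gr_coeffs x)" for X
    using that by (induction X) (auto simp: in_keys_iff intro!: assms)
  then show ?thesis
    by (subst gr_basis_expansion) simp
qed

lemma gr_coeff_minus: "gr_coeff (x - y) A = gr_coeff x A - gr_coeff y A"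
  by transfer (simp add: lookup_minus)

lemma gr_coeff_part: "gr_coeff (gr_part b x) A = (if even (fcard A) = b then gr_coeff x A else 0)"
  by (simp add: gr_part_def lookup_gr_sum lookup_gr_basis if_distrib in_keys_iff cong: if_cong)

lemma gr_part_add: "gr_part True x + gr_part False x = x"
  by (rule gr_eqI) (simp add: lookup_gr_add gr_coeff_part)

lemma gr_parity_part: "gr_parity b (gr_part b x)"
  by (simp add: gr_parity_def gr_coeff_part split: if_splits)

lemma gr_part_grassmann0: "x \<in> grassmann0 \<Longrightarrow> gr_part b x \<in> grassmann0"
  by (simp add: grassmann0_def gr_coeff_part)

lemma gr_parity_zero: "gr_parity b 0"
  by (simp add: gr_parity_def lookup_gr_zero)

lemma gr_parity_one: "gr_parity True 1"
  by (auto simp: gr_parity_def gr_basis_empty[symmetric] lookup_gr_basis fcard_fempty split: if_splits)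

lemma gr_parity_add: "gr_parity b x \<Longrightarrow> gr_parity b y \<Longrightarrow> gr_parity b (x + y)"
  unfolding gr_parity_def lookup_gr_add by (metis add.right_neutral add_0)

lemma gr_parity_scale: "gr_parity b x \<Longrightarrow> gr_parity b (gr_scale c x)"
  by (simp add: gr_parity_def)

lemma gr_parity_minus: "gr_parity b x \<Longrightarrow> gr_parity b y \<Longrightarrow> gr_parity b (x - y)"
  unfolding gr_parity_def gr_coeff_minus by (metis diff_self)

lemma gr_parity_sum: "(\<And>i. i \<in> I \<Longrightarrow> gr_parity b (h i)) \<Longrightarrow> gr_parity b (sum h I)"
  by (induction I rule: infinite_finite_induct) (auto simp: gr_parity_zero gr_parity_add)

lemma gr_parity_basis: "gr_parity (even (fcard A)) (gr_basis A)"
  by (simp add: gr_parity_def lookup_gr_basis split: if_splits)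

lemma gr_parity_both_zero: "gr_parity True x \<Longrightarrow> gr_parity False x \<Longrightarrow> x = 0"
  by (rule gr_eqI) (auto simp: gr_parity_def lookup_gr_zero)

section \<open>Signs, supercommutativity and commutators\<close>

lemma inversions_swap:
  assumes "A |\<inter>| B = {||}"
  shows "inversions A B + inversions B A = fcard A * fcard B"
proof -
  let ?X = "{(i, j). i |\<in>| A \<and> j |\<in>| B \<and> j < i}" and ?Y = "{(i, j). i |\<in>| B \<and> j |\<in>| A \<and> j < i}"
  let ?Y' = "{(i, j). i |\<in>| A \<and> j |\<in>| B \<and> i < j}"
  have fin: "finite ?X" "finite ?Y'"
    by (rule finite_subset[of _ "fset A \<times> fset B"]; auto)+
  have "card ?Y = card ?Y'"
    by (rule bij_betw_same_card[of prod.swap]) (auto simp: bij_betw_def inj_on_def image_def)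
  \<comment> \<open>Disjointness excludes i = j, so each pair is an inversion in exactly one of the
    two orders.\<close>
  moreover have "?X \<union> ?Y' = fset A \<times> fset B"
  proof -
    have "i \<noteq> j" if "i |\<in>| A" "j |\<in>| B" for i j
      using that assms by auto
    then show ?thesis by fastforce
  qed
  moreover have "card (?X \<union> ?Y') = card ?X + card ?Y'"
    using fin by (intro card_Un_disjoint) auto
  ultimately show ?thesis
    by (simp add: inversions_def card_cartesian_product fcard.rep_eq)
qed

lemma gr_sign_swap:
  "gr_sign A B = (-1) ^ (fcard A * fcard B) * (gr_sign B A :: 'k::field)"
proof (cases "A |\<inter>| B = {||}")
  case True
  \<comment> \<open>The sign of B against A is inserted twice, which changes nothing since it
    squares to 1.\<close>
  have "(-1 :: 'k) ^ inversions A B = (-1) ^ (inversions A B + inversions B A) * (-1) ^ inversions B A"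
    by (simp add: power_add mult.assoc flip: power_mult_distrib)
  with True show ?thesis
    by (simp add: gr_sign_def inf_commute inversions_swap)
qed (auto simp: gr_sign_def inf_commute)

lemma gr_basis_commute:
  "gr_basis A * gr_basis B = gr_scale ((-1) ^ (fcard A * fcard B)) (gr_basis B * gr_basis A)"
  by (simp add: gr_basis_mult gr_sign_swap[of A B] sup_commute)

lemma gr_basis_square: "A \<noteq> {||} \<Longrightarrow> gr_basis A * gr_basis A = 0"
  by (simp add: gr_basis_mult gr_sign_def)

text \<open>Sizes of disjoint index sets add, and with \<open>True\<close> for even the sum of two
  parities is \<open>b = c\<close>.\<close>

lemma gr_parity_mult:
  assumes "gr_parity b x" "gr_parity c y"
  shows "gr_parity (b = c) (x * y)"
proof -
  have one: "gr_parity (b = c) (gr_basis A * gr_basis B)"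
    if "even (fcard A) = b" "even (fcard B) = c" for A B
  proof (cases "A |\<inter>| B = {||}")
    case True
    then show ?thesis using gr_parity_basis[of "A |\<union>| B"] that
      by (auto simp: gr_basis_mult fcard_funion_disjoint intro!: gr_parity_scale)
  qed (simp add: gr_basis_mult gr_sign_def gr_parity_zero)
  show ?thesis
  proof (induction x rule: gr_support_induct[where Q = "\<lambda>A. even (fcard A) = b"])
    case supp with assms(1) show ?case by (simp add: gr_parity_def)
  next
    case (single A d)
    have "gr_parity (b = c) (gr_basis A * y)"
    proof (induction y rule: gr_support_induct[where Q = "\<lambda>A. even (fcard A) = c"])
      case supp with assms(2) show ?case by (simp add: gr_parity_def)
    qed (auto simp: gr_parity_zero distrib_left gr_parity_add one gr_parity_scale single
          simp flip: gr_scale_mult)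
    then show ?case by (simp add: gr_parity_scale flip: gr_scale_mult)
  qed (auto simp: gr_parity_zero distrib_right gr_parity_add)
qed

lemma gr_parity_power: "gr_parity True x \<Longrightarrow> gr_parity True (x ^ n)"
  using gr_parity_mult[of True x True] by (induction n) (auto simp: gr_parity_one)

lemma gr_basis_mult_commute:
  assumes "gr_parity b x"
  shows "gr_basis A * x = gr_scale (if b then 1 else (-1) ^ fcard A) (x * gr_basis A)"
proof (induction x rule: gr_support_induct[where Q = "\<lambda>A. even (fcard A) = b"])
  case supp with assms show ?case by (simp add: gr_parity_def)
next
  case (single B c)
  have *: "gr_basis A * gr_basis B =
      gr_scale (if b then 1 else (-1) ^ fcard A) (gr_basis B * gr_basis A :: 'a grassmann)"
    using single by (subst gr_basis_commute) (auto simp: power_mult mult.commute[of "fcard A"])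
  show ?case
    by (simp only: gr_scale_mult[symmetric] * gr_vs.scale_left_commute[of c])
qed (auto simp: distrib_left distrib_right gr_vs.scale_right_distrib)

lemma gr_even_commute:
  assumes "gr_parity True x"
  shows "x * y = y * x"
proof (induction y rule: gr_support_induct[where Q = "\<lambda>_. True"])
  case (single B c)
  show ?case
    using gr_basis_mult_commute[OF assms, of B] by (simp flip: gr_scale_mult)
qed (auto simp: distrib_left distrib_right)

lemma gr_odd_anticommute:
  assumes "gr_parity False x" "gr_parity False y"
  shows "x * y = - (y * x)"
proof (induction y rule: gr_support_induct[where Q = "\<lambda>A. even (fcard A) = False"])
  case supp with assms(2) show ?case by (simp add: gr_parity_def)
next
  case (single B c)
  then show ?case
    using gr_basis_mult_commute[OF assms(1), of B] by (simp flip: gr_scale_mult)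
qed (auto simp: distrib_left distrib_right)

lemma two_neq_0_if_CHAR:
  assumes "CHAR('k::field) \<noteq> 2"
  shows "(2 :: 'k) \<noteq> 0"
proof
  assume "(2 :: 'k) = 0"
  then have "CHAR('k) dvd 2" using of_nat_eq_0_iff_char_dvd[of 2, where 'a = 'k] by simp
  then have "CHAR('k) \<le> 2" by (rule dvd_imp_le) simp
  moreover have "CHAR('k) \<noteq> 0" using \<open>CHAR('k) dvd 2\<close> by (metis dvd_0_left zero_neq_numeral)
  moreover have "CHAR('k) \<noteq> 1" by (simp add: CHAR_not_1)
  ultimately show False using assms by linarith
qed

lemma gr_double_eq_0:
  assumes "CHAR('k::field) \<noteq> 2" "x + x = (0 :: 'k grassmann)"
  shows "x = 0"
proof -
  have "gr_scale 2 x = 0"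
    using assms(2) gr_vs.scale_left_distrib[of 1 1 x] by simp
  then show ?thesis
    using two_neq_0_if_CHAR[OF assms(1)] by simp
qed

lemma gr_odd_square:
  assumes "CHAR('k::field) \<noteq> 2" "gr_parity False (x :: 'k grassmann)"
  shows "x * x = 0"
  using gr_odd_anticommute[OF assms(2,2)] gr_double_eq_0[OF assms(1)] by (metis add.right_inverse)

text \<open>Even parts commute with everything and odd parts anticommute, so only the product of the
  odd parts survives, counted twice.\<close>

lemma gr_commutator:
  "commutator x y = gr_part False x * gr_part False y + gr_part False x * gr_part False y"
proof -
  define a b where "a = gr_part True x" and "b = gr_part False x"
  define c d where "c = gr_part True y" and "d = gr_part False y"
  have x: "x = a + b" "y = c + d"
    by (simp_all add: a_def b_def c_def d_def gr_part_add)
  have "commutator x y = (a * c - c * a) + (a * d - d * a) + (b * c - c * b) + (b * d - d * b)"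
    unfolding commutator_def x by (simp add: algebra_simps)
  moreover have "a * c = c * a" "a * d = d * a" "b * c = c * b"
    unfolding a_def c_def
    by (rule gr_even_commute[OF gr_parity_part] gr_even_commute[OF gr_parity_part, symmetric])+
  moreover have "d * b = - (b * d)"
    unfolding b_def d_def by (intro gr_odd_anticommute gr_parity_part)
  ultimately show ?thesis
    by (simp add: b_def d_def)
qed

lemma gr_parity_commutator: "gr_parity True (commutator x y)"
  using gr_parity_mult[OF gr_parity_part[of False x] gr_parity_part[of False y]]
  by (simp add: gr_commutator gr_parity_add)

section \<open>Reading off coefficients; the centre of G_0\<close>

lemma gr_coeff_basis_mult:
  assumes "A |\<inter>| B = {||}"
  shows "gr_coeff (gr_basis B * x) (A |\<union>| B) = gr_sign B A * gr_coeff x A"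
proof (induction x rule: gr_support_induct[where Q = "\<lambda>_. True"])
  case (single C c)
  have e: "gr_basis B * gr_scale c (gr_basis C) = gr_scale (c * gr_sign B C) (gr_basis (B |\<union>| C))"
    by (simp add: gr_basis_mult flip: gr_scale_mult(2))
  \<comment> \<open>If C differs from A yet has the same union with B, then C meets B and the sign
    is 0.\<close>
  have "B |\<union>| C \<noteq> A |\<union>| B" if "B |\<inter>| C = {||}" "C \<noteq> A"
  proof
    assume u: "B |\<union>| C = A |\<union>| B"
    have "C = (B |\<union>| C) |-| B"
      using that(1) by auto
    also have "\<dots> = A"
      unfolding u using assms by auto
    finally show False using that(2) by simp
  qed
  then show ?case
    unfolding e by (cases "C = A") (auto simp: lookup_gr_basis sup_commute gr_sign_def)
qed (auto simp: lookup_gr_zero distrib_left lookup_gr_add)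

lemma gr_sign_disjoint_nonzero: "A |\<inter>| B = {||} \<Longrightarrow> gr_sign A B \<noteq> (0 :: 'k::field)"
  by (simp add: gr_sign_def)

text \<open>Here the infinite supply of generators enters.\<close>

lemma ex_fresh_fset: "\<exists>B. fcard B = n \<and> A |\<inter>| B = ({||} :: nat fset)"
proof -
  have "infinite (UNIV - fset A)" by simp
  then obtain X where "finite X" "card X = n" "X \<subseteq> UNIV - fset A"
    using infinite_arbitrarily_large by blast
  then show ?thesis
    by (intro exI[of _ "Abs_fset X"]) (auto simp: fcard.rep_eq Abs_fset_inverse fset_eq_iff)
qed

text \<open>For B disjoint from A, the coefficient of x at A reappears up to sign in the product at
  the union of A and B, and B can be chosen so that this union has odd size.\<close>

lemma gr_eq_0_if_basis_mult_even:
  assumes "\<And>B. B \<noteq> {||} \<Longrightarrow> gr_parity True (gr_basis B * x)"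
  shows "x = 0"
proof (rule gr_eqI)
  fix A :: "nat fset"
  \<comment> \<open>One more than the size of A makes the union odd whatever the parity of A, and
    keeps B nonempty.\<close>
  obtain B where B: "fcard B = Suc (fcard A)" "A |\<inter>| B = {||}"
    using ex_fresh_fset[of "Suc (fcard A)" A] by blast
  then have "odd (fcard (A |\<union>| B))"
    by (simp only: fcard_funion_disjoint[OF B(2)]) simp
  moreover have "B \<noteq> {||}"
    using B(1) fcard_fempty by (metis nat.distinct(1))
  ultimately have "gr_sign B A * gr_coeff x A = 0"
    using assms[of B] gr_coeff_basis_mult[OF B(2), of x] by (auto simp: gr_parity_def)
  then show "gr_coeff x A = gr_coeff 0 A"
    using B by (simp add: gr_sign_disjoint_nonzero inf_commute lookup_gr_zero)
qed

lemma gr_basis_grassmann0: "A \<noteq> {||} \<Longrightarrow> gr_basis A \<in> grassmann0"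
  by (simp add: grassmann0_def lookup_gr_basis)

text \<open>The odd part y of a central x both commutes and anticommutes with a generator e, so 2 e
  y = 0; taking e outside A shows that y has no coefficient at A.\<close>

lemma center_of_grassmann0:
  assumes "CHAR('k::field) \<noteq> 2"
  shows "x \<in> center_of grassmann0 \<longleftrightarrow> x \<in> grassmann0 \<and> gr_parity True (x :: 'k grassmann)"
proof
  assume x: "x \<in> center_of grassmann0"
  define y where "y = gr_part False x"
  have "gr_coeff y A = gr_coeff 0 A" for A :: "nat fset"
  proof -
    obtain B where B: "fcard B = 1" "A |\<inter>| B = {||}"
      using ex_fresh_fset[of 1 A] by blast
    let ?e = "gr_basis B :: 'k grassmann"
    have "?e \<in> grassmann0"
      using B by (intro gr_basis_grassmann0) (auto simp: fcard_fempty)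
    then have "x * ?e = ?e * x"
      using x by (simp add: center_of_def)
    moreover have "x = gr_part True x + y"
      by (simp add: y_def gr_part_add)
    moreover have "gr_part True x * ?e = ?e * gr_part True x"
      by (intro gr_even_commute gr_parity_part)
    ultimately have "y * ?e = ?e * y"
      by (metis add_left_cancel distrib_left distrib_right)
    moreover have "?e * y = - (y * ?e)"
      using B gr_basis_mult_commute[OF gr_parity_part, of B False x] by (simp add: y_def)
    ultimately have "?e * y + ?e * y = 0" by (metis add.right_inverse)
    then have "?e * y = 0" by (rule gr_double_eq_0[OF assms])
    then show ?thesis
      using gr_coeff_basis_mult[OF B(2), of y] gr_sign_disjoint_nonzero[of B A] B(2)
      by (auto simp: lookup_gr_zero inf_commute)
  qed
  then have "y = 0" by (rule gr_eqI)
  then show "x \<in> grassmann0 \<and> gr_parity True x"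
    using x gr_part_add[of x] gr_parity_part[of True x] by (auto simp: y_def center_of_def)
qed (auto simp: center_of_def gr_even_commute)

section \<open>Nilpotence: sandwiches and p-th powers\<close>

lemma gr_basis_sandwich:
  assumes "A \<noteq> {||}"
  shows "gr_basis A * x * gr_basis A = 0"
proof (induction x rule: gr_support_induct[where Q = "\<lambda>_. True"])
  case (single B c)
  \<comment> \<open>Moving the last factor past the middle one costs only a sign and brings the two
    equal factors together.\<close>
  have "gr_basis A * gr_basis B * gr_basis A =
      gr_basis A * gr_scale ((-1) ^ (fcard B * fcard A)) (gr_basis A * gr_basis B :: 'a grassmann)"
    by (simp only: mult.assoc gr_basis_commute[of B A])
  also have "\<dots> = gr_scale ((-1) ^ (fcard B * fcard A)) (gr_basis A * gr_basis A * gr_basis B)"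
    by (simp only: mult.assoc gr_scale_mult(2))
  also have "\<dots> = 0"
    using assms by (simp add: gr_basis_square)
  finally show ?case
    by (simp flip: gr_scale_mult)
qed (auto simp: distrib_left distrib_right)

text \<open>The binomial expansion stops after the linear term. For n = 0 the truncated exponent n -
  1 is harmless, its coefficient being 0.\<close>

lemma power_add_square_zero:
  fixes u b :: "'a::ring_1"
  assumes "u * b = b * u" "b * b = 0"
  shows "(u + b) ^ n = u ^ n + of_nat n * (u ^ (n - 1) * b)"
proof (induction n)
  case (Suc n)
  have bu: "b * u ^ m = u ^ m * b" for m
    by (metis assms(1) power_commuting_commutes)
  have u: "of_nat n * (u * (u ^ (n - 1) * b)) = of_nat n * (u ^ n * b)"
    by (cases n) (simp_all add: mult.assoc)
  have "(u + b) ^ Suc n = u * u ^ n + b * u ^ n + u * (of_nat n * (u ^ (n - 1) * b))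
      + b * (of_nat n * (u ^ (n - 1) * b))"
    by (simp add: Suc distrib_left distrib_right)
  also have "u * (of_nat n * (u ^ (n - 1) * b)) = of_nat n * (u ^ n * b)"
    by (metis u mult.assoc mult_of_nat_commute)
  also have "b * (of_nat n * (u ^ (n - 1) * b)) = of_nat n * (b * (u ^ (n - 1) * b))"
    by (metis mult.assoc mult_of_nat_commute)
  also have "b * (u ^ (n - 1) * b) = u ^ (n - 1) * (b * b)"
    by (simp only: bu mult.assoc[symmetric])
  also have "u * u ^ n + b * u ^ n + of_nat n * (u ^ n * b) + of_nat n * (u ^ (n - 1) * (b * b)) =
      u ^ Suc n + of_nat (Suc n) * (u ^ (Suc n - 1) * b)"
    by (simp add: assms(2) bu distrib_right add.assoc)
  finally show ?case .
qed simp

lemma gr_of_nat: "of_nat n * x = gr_scale (of_nat n) (x :: 'k::field grassmann)"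
  by (induction n) (auto simp: distrib_right gr_vs.scale_left_distrib)

text \<open>The even terms are added one at a time. Each has square zero, its index set being
  nonempty, so the only new contribution carries the factor p = 0.\<close>

lemma gr_even_power_CHAR:
  fixes x :: "'k::field grassmann"
  assumes "CHAR('k) \<noteq> 0" "x \<in> grassmann0" "gr_parity True x"
  shows "x ^ CHAR('k) = 0"
proof -
  let ?h = "\<lambda>A. gr_scale (gr_coeff x A) (gr_basis A)"
  have "(\<Sum>A\<in>Y. ?h A) ^ CHAR('k) = 0" if "finite Y" "Y \<subseteq> Poly_Mapping.keys (gr_coeffs x)" for Y
    using that
  proof (induction Y)
    case empty
    then show ?case using assms(1) by (simp add: zero_power)
  next
    case (insert A Y)
    let ?u = "\<Sum>A\<in>Y. ?h A"
    have A: "A \<noteq> {||}" "even (fcard A)"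
      using insert assms by (auto simp: in_keys_iff grassmann0_def gr_parity_def)
    then have "gr_parity True (?h A)"
      by (intro gr_parity_scale) (metis gr_parity_basis)
    moreover have "?h A * ?h A = 0"
      using A by (simp add: gr_basis_square flip: gr_scale_mult)
    ultimately have "(?u + ?h A) ^ CHAR('k) =
        ?u ^ CHAR('k) + of_nat CHAR('k) * (?u ^ (CHAR('k) - 1) * ?h A)"
      by (intro power_add_square_zero gr_even_commute[symmetric])
    then show ?case
      using insert by (simp add: gr_of_nat add.commute)
  qed
  from this[of "Poly_Mapping.keys (gr_coeffs x)"] show ?thesis
    by (simp flip: gr_basis_expansion)
qed

section \<open>Evaluation of noncommutative polynomials\<close>

text \<open>One substitution map serves for values in the Grassmann algebra and for endomorphisms of
  the free algebra. The target has a unit, so the empty word needs no separate case.\<close>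

definition eval :: "('k::field \<Rightarrow> 'b::ring_1 \<Rightarrow> 'b) \<Rightarrow> (nat \<Rightarrow> 'b) \<Rightarrow> 'k free_alg \<Rightarrow> 'b" where
  "eval s g f = (\<Sum>w\<in>Poly_Mapping.keys f.
     s (Poly_Mapping.lookup f w) (prod_list (map g (letters w))))"

lemma single_in_free_alg0: "w \<noteq> Word [] \<Longrightarrow> Poly_Mapping.single w c \<in> free_alg0"
  by (simp add: free_alg0_def lookup_single when_def)

lemma var_in_free_alg0: "var i \<in> free_alg0"
  by (simp add: var_def single_in_free_alg0)

lemma keys_free_alg0: "f \<in> free_alg0 \<Longrightarrow> w \<in> Poly_Mapping.keys f \<Longrightarrow> w \<noteq> Word []"
  by (auto simp: free_alg0_def in_keys_iff)

lemma subspace_free_alg0: "free_vs.subspace free_alg0"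
  by (rule conjunct1[OF subalgebra_free_alg0[unfolded subalgebra_def]])

lemma mult_in_free_alg0: "f \<in> free_alg0 \<Longrightarrow> h \<in> free_alg0 \<Longrightarrow> f * h \<in> free_alg0"
  by (metis subalgebra_free_alg0 subalgebra_def)

lemma free_scale_single: "free_scale c (Poly_Mapping.single w d) = Poly_Mapping.single w (c * d)"
  by (rule poly_mapping_eqI) (simp add: lookup_single when_def)

lemma free_alg_expansion:
  "f = (\<Sum>w\<in>Poly_Mapping.keys f. free_scale (Poly_Mapping.lookup f w) (Poly_Mapping.single w 1))"
  by (rule poly_mapping_eqI) (simp add: lookup_sum free_scale_single lookup_single when_def in_keys_iff)

locale scalar_algebra = module s
  for s :: "'k::field \<Rightarrow> 'b::ring_1 \<Rightarrow> 'b" +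
  assumes scale_mult_left: "s c (x * y) = s c x * y"
    and scale_mult_right: "s c (x * y) = x * s c y"
begin

lemma eval_superset:
  assumes "finite X" "Poly_Mapping.keys f \<subseteq> X"
  shows "eval s g f = (\<Sum>w\<in>X. s (Poly_Mapping.lookup f w) (prod_list (map g (letters w))))"
  unfolding eval_def
  by (intro sum.mono_neutral_left) (use assms in \<open>auto simp: in_keys_iff\<close>)

lemma eval_zero: "eval s g 0 = 0"
  by (simp add: eval_def)

lemma eval_single: "eval s g (Poly_Mapping.single w c) = s c (prod_list (map g (letters w)))"
  by (subst eval_superset[of "{w}"]) auto

lemma eval_add: "eval s g (f + h) = eval s g f + eval s g h"
proof -
  let ?X = "Poly_Mapping.keys f \<union> Poly_Mapping.keys h"
  show ?thesis
    using Poly_Mapping.keys_add[of f h]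
    by (simp add: eval_superset[of ?X] lookup_add scale_left_distrib sum.distrib)
qed

lemma eval_scale: "eval s g (free_scale c f) = s c (eval s g f)"
proof -
  have "Poly_Mapping.keys (free_scale c f) \<subseteq> Poly_Mapping.keys f"
    by (auto simp: in_keys_iff)
  then show ?thesis
    by (simp add: eval_superset[of "Poly_Mapping.keys f"] scale_sum_right)
qed

lemma eval_sum: "eval s g (sum h I) = (\<Sum>i\<in>I. eval s g (h i))"
  by (induction I rule: infinite_finite_induct) (simp_all add: eval_zero eval_add)

lemma eval_diff: "eval s g (f - h) = eval s g f - eval s g h"
  by (metis add_diff_cancel diff_add_cancel eval_add)

lemma eval_mult: "eval s g (f * h) = eval s g f * eval s g h"
proof (induction f rule: pm_induct)
  case (single v a)
  show ?case
  proof (induction h rule: pm_induct)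
    case (single w b)
    show ?case
      by (simp add: mult_single eval_single plus_word_def mult.commute[of b a] flip: scale_mult_left scale_mult_right)
  qed (simp_all add: eval_zero eval_add distrib_left)
qed (simp_all add: eval_zero eval_add distrib_right)

lemma eval_one: "eval s g 1 = 1"
proof -
  have "letters (0 :: nat word) = []" by (simp add: zero_word_def)
  then show ?thesis using eval_single[of g 0 1] by simp
qed

lemma eval_var: "eval s g (var i) = g i"
  by (simp add: var_def eval_single)

lemma eval_power: "eval s g (f ^ n) = eval s g f ^ n"
  by (induction n) (simp_all add: eval_one eval_mult)

lemma eval_prod_list: "eval s g (prod_list fs) = prod_list (map (eval s g) fs)"
  by (induction fs) (simp_all add: eval_one eval_mult)

lemma eval_commutator: "eval s g (commutator f h) = commutator (eval s g f) (eval s g h)"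
  by (simp add: commutator_def eval_diff eval_mult)

lemma eval_eval: "eval s g (eval free_scale h f) = eval s (\<lambda>i. eval s g (h i)) f"
proof (induction f rule: pm_induct)
  case (single w c)
  interpret free: scalar_algebra free_scale
    by unfold_locales (rule free_scale_mult)+
  show ?case
    by (simp add: eval_single free.eval_single eval_scale eval_prod_list comp_def)
next
  case (add f h)
  interpret free: scalar_algebra free_scale
    by unfold_locales (rule free_scale_mult)+
  from add show ?case
    by (simp add: eval_add free.eval_add)
qed (simp add: eval_def)

lemma prod_list_closed:
  assumes "subalgebra s B" "xs \<noteq> []" "set xs \<subseteq> B"
  shows "prod_list xs \<in> B"
  using assms(2,3)
proof (induction xs rule: list_nonempty_induct)
  case (cons x xs)
  then show ?case using assms(1) by (simp add: subalgebra_def)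
qed simp

lemma algebra_hom_eval:
  assumes B: "subalgebra s B" and g: "\<And>i. g i \<in> B"
  shows "algebra_hom free_scale s free_alg0 B (eval s g)"
proof -
  have "eval s g f \<in> B" if "f \<in> free_alg0" for f
    unfolding eval_def
  proof (intro subspace_sum subspace_scale)
    fix w assume "w \<in> Poly_Mapping.keys f"
    then have "letters w \<noteq> []"
      using keys_free_alg0[OF that] by (metis word.collapse)
    then show "prod_list (map g (letters w)) \<in> B"
      using g by (intro prod_list_closed[OF B]) auto
  qed (use B in \<open>auto simp: subalgebra_def\<close>)
  then show ?thesis
    by (simp add: algebra_hom_def eval_add eval_mult eval_scale)
qed

text \<open>The map is known to respect the operations on \<open>free_alg0\<close> only, so f is
  built from nonempty words with every partial sum kept inside \<open>free_alg0\<close>.\<close>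

lemma algebra_hom_eq_eval:
  assumes h: "algebra_hom free_scale s free_alg0 B \<phi>" and f: "f \<in> free_alg0"
  shows "\<phi> f = eval s (\<lambda>i. \<phi> (var i)) f"
proof -
  have add: "\<phi> (x + y) = \<phi> x + \<phi> y" if "x \<in> free_alg0" "y \<in> free_alg0" for x y
    using h that by (simp add: algebra_hom_def)
  have zero_in: "0 \<in> free_alg0"
    by (rule free_vs.subspace_0[OF subspace_free_alg0])
  have zero: "\<phi> 0 = 0"
    using add[OF zero_in zero_in] by simp
  have word: "\<phi> (Poly_Mapping.single (Word xs) 1) = prod_list (map (\<lambda>i. \<phi> (var i)) xs)"
    if "xs \<noteq> []" for xs
    using that
  proof (induction xs rule: list_nonempty_induct)
    case (cons x xs)
    have "Poly_Mapping.single (Word (x # xs)) 1 =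
        var x * (Poly_Mapping.single (Word xs) 1 :: 'k free_alg)"
      by (simp add: var_def mult_single plus_word_def)
    with cons h show ?case
      by (simp add: algebra_hom_def var_in_free_alg0 single_in_free_alg0)
  qed (simp flip: var_def)
  have "\<phi> (\<Sum>w\<in>X. free_scale (Poly_Mapping.lookup f w) (Poly_Mapping.single w 1)) =
      (\<Sum>w\<in>X. s (Poly_Mapping.lookup f w) (prod_list (map (\<lambda>i. \<phi> (var i)) (letters w))))"
    if "finite X" "X \<subseteq> Poly_Mapping.keys f" for X
    using that
  proof (induction X)
    case (insert w X)
    have nz: "v \<noteq> Word []" if "v \<in> insert w X" for v
      using insert.prems that keys_free_alg0[OF f] by blast
    have "(\<Sum>w\<in>X. free_scale (Poly_Mapping.lookup f w) (Poly_Mapping.single w 1)) \<in> free_alg0"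
      using nz by (intro free_vs.subspace_sum[OF subspace_free_alg0]
          free_vs.subspace_scale[OF subspace_free_alg0] single_in_free_alg0) auto
    moreover have "free_scale (Poly_Mapping.lookup f w) (Poly_Mapping.single w 1) \<in> free_alg0"
      using nz by (intro free_vs.subspace_scale[OF subspace_free_alg0] single_in_free_alg0) auto
    moreover have "letters w \<noteq> []"
      using nz[of w] by (metis insertI1 word.collapse)
    then have "\<phi> (free_scale (Poly_Mapping.lookup f w) (Poly_Mapping.single w 1)) =
        s (Poly_Mapping.lookup f w) (prod_list (map (\<lambda>i. \<phi> (var i)) (letters w)))"
      using h nz[of w] word[of "letters w"] by (simp add: algebra_hom_def single_in_free_alg0)
    ultimately show ?case
      using insert by (simp add: add)
  qed (simp add: zero)
  from this[of "Poly_Mapping.keys f"] show ?thesis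
    by (simp add: eval_def flip: free_alg_expansion)
qed

end

section \<open>Values on G_0: identities and even-valued polynomials\<close>

interpretation free: scalar_algebra free_scale
  by unfold_locales (rule free_scale_mult)+

interpretation gr: scalar_algebra gr_scale
  by unfold_locales (rule gr_scale_mult)+

abbreviation gr_eval :: "(nat \<Rightarrow> 'k::field grassmann) \<Rightarrow> 'k free_alg \<Rightarrow> 'k grassmann" where
  "gr_eval \<equiv> eval gr_scale"

text \<open>In characteristic different from 2 these are the polynomials with central values,
  identities included; unlike the central polynomials they form a subspace.\<close>

definition even_valued :: "'k::field free_alg set" where
  "even_valued = {f \<in> free_alg0. \<forall>g. range g \<subseteq> grassmann0 \<longrightarrow> gr_parity True (gr_eval g f)}"

lemma all_gr_hom_iff:
  assumes "f \<in> free_alg0"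
  shows "(\<forall>\<phi>. algebra_hom free_scale gr_scale free_alg0 grassmann0 \<phi> \<longrightarrow> Q (\<phi> f)) \<longleftrightarrow>
    (\<forall>g. range g \<subseteq> grassmann0 \<longrightarrow> Q (gr_eval g f))"
proof safe
  fix g :: "nat \<Rightarrow> 'a grassmann"
  assume "\<forall>\<phi>. algebra_hom free_scale gr_scale free_alg0 grassmann0 \<phi> \<longrightarrow> Q (\<phi> f)"
    and "range g \<subseteq> grassmann0"
  then show "Q (gr_eval g f)"
    using gr.algebra_hom_eval[OF subalgebra_grassmann0, of g] by blast
next
  fix \<phi> :: "'a free_alg \<Rightarrow> 'a grassmann"
  assume all: "\<forall>g. range g \<subseteq> grassmann0 \<longrightarrow> Q (gr_eval g f)"
    and h: "algebra_hom free_scale gr_scale free_alg0 grassmann0 \<phi>"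
  have "range (\<lambda>i. \<phi> (var i)) \<subseteq> grassmann0"
    using h by (auto simp: algebra_hom_def var_in_free_alg0)
  then show "Q (\<phi> f)"
    using all gr.algebra_hom_eq_eval[OF h assms] by simp
qed

lemma identities_G0_eq:
  "identities_G0 = {f \<in> free_alg0. \<forall>g. range g \<subseteq> grassmann0 \<longrightarrow> gr_eval g f = 0}"
  unfolding identities_G0_def using all_gr_hom_iff[where Q = "\<lambda>x. x = 0"] by blast

lemma gr_eval_in_grassmann0:
  "range g \<subseteq> grassmann0 \<Longrightarrow> f \<in> free_alg0 \<Longrightarrow> gr_eval g f \<in> grassmann0"
  using gr.algebra_hom_eval[OF subalgebra_grassmann0, of g]
  unfolding algebra_hom_def by blast

lemma even_valued_eq:
  assumes "CHAR('k::field) \<noteq> 2"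
  shows "(even_valued :: 'k free_alg set) = {f \<in> free_alg0.
     \<forall>\<phi>. algebra_hom free_scale gr_scale free_alg0 grassmann0 \<phi> \<longrightarrow> \<phi> f \<in> center_of grassmann0}"
proof -
  have "(\<forall>g. range g \<subseteq> grassmann0 \<longrightarrow> gr_parity True (gr_eval g f)) \<longleftrightarrow>
     (\<forall>\<phi>. algebra_hom free_scale gr_scale free_alg0 grassmann0 \<phi> \<longrightarrow> \<phi> f \<in> center_of grassmann0)"
    if "f \<in> free_alg0" for f :: "'k free_alg"
    unfolding all_gr_hom_iff[OF that, of "\<lambda>x. x \<in> center_of grassmann0"]
    unfolding center_of_grassmann0[OF assms]
    using gr_eval_in_grassmann0[OF _ that] by blast
  then show ?thesis
    unfolding even_valued_def by blast
qed

lemma subspace_identities_G0: "free_vs.subspace (identities_G0 :: 'k::field free_alg set)"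
  unfolding identities_G0_eq free_vs.subspace_def
  using subspace_free_alg0[where 'a = 'k]
  by (auto simp: free_vs.subspace_def gr.eval_zero gr.eval_add gr.eval_scale)

lemma subspace_even_valued: "free_vs.subspace (even_valued :: 'k::field free_alg set)"
  unfolding even_valued_def free_vs.subspace_def
  using subspace_free_alg0[where 'a = 'k]
  by (auto simp: free_vs.subspace_def gr.eval_zero gr.eval_add gr.eval_scale
      gr_parity_zero gr_parity_add gr_parity_scale)

lemma identities_subset_even_valued: "identities_G0 \<subseteq> even_valued"
  by (auto simp: identities_G0_eq even_valued_def gr_parity_zero)

lemma T_space_even_valued: "T_space free_scale free_alg0 (even_valued :: 'k::field free_alg set)"
  unfolding T_space_def
proof (intro conjI subspace_even_valued allI impI subsetI)
  show "x \<in> free_alg0" if "x \<in> even_valued" for x :: "'k free_alg"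
    using that by (simp add: even_valued_def)
next
  fix \<phi> :: "'k free_alg \<Rightarrow> 'k free_alg" and y
  assume h: "algebra_hom free_scale free_scale free_alg0 free_alg0 \<phi>" and "y \<in> \<phi> ` even_valued"
  then obtain f where f: "f \<in> even_valued" "y = \<phi> f" by blast
  then have f0: "f \<in> free_alg0" by (simp add: even_valued_def)
  have y: "y \<in> free_alg0"
    using h f0 f(2) by (simp add: algebra_hom_def)
  have "gr_parity True (gr_eval g y)" if "range g \<subseteq> grassmann0" for g
  proof -
    \<comment> \<open>Applying an endomorphism and then evaluating amounts to evaluating at another
      assignment.\<close>
    have "range (\<lambda>i. gr_eval g (\<phi> (var i))) \<subseteq> grassmann0"
      using h gr_eval_in_grassmann0[OF that] by (auto simp: algebra_hom_def var_in_free_alg0)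
    then show ?thesis
      using f by (simp add: free.algebra_hom_eq_eval[OF h f0] gr.eval_eval even_valued_def)
  qed
  with y show "y \<in> even_valued" by (simp add: even_valued_def)
qed

lemma commutator_in_free_alg0: "f \<in> free_alg0 \<Longrightarrow> h \<in> free_alg0 \<Longrightarrow> commutator f h \<in> free_alg0"
  unfolding commutator_def by (intro free_vs.subspace_diff[OF subspace_free_alg0] mult_in_free_alg0)

lemma commutator_even_valued:
  "f \<in> free_alg0 \<Longrightarrow> h \<in> free_alg0 \<Longrightarrow> commutator f h \<in> even_valued"
  by (simp add: even_valued_def commutator_in_free_alg0 gr.eval_commutator gr_parity_commutator)

text \<open>On the generators the commutator takes the value 2 e_1 e_2.\<close>

lemma commutator_not_identity:
  assumes "CHAR('k::field) \<noteq> 2"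
  shows "commutator (var 1) (var 2) \<notin> (identities_G0 :: 'k free_alg set)"
proof
  let ?x = "gr_gen 1 * gr_gen 2 :: 'k grassmann"
  assume "commutator (var 1) (var 2) \<in> (identities_G0 :: 'k free_alg set)"
  moreover have "range gr_gen \<subseteq> (grassmann0 :: 'k grassmann set)"
    by (auto simp: gr_gen_def intro!: gr_basis_grassmann0)
  ultimately have "gr_eval gr_gen (commutator (var 1) (var 2)) = (0 :: 'k grassmann)"
    by (simp add: identities_G0_eq)
  then have "?x + ?x = 0"
    by (simp add: commutator_def gr.eval_diff gr.eval_mult gr.eval_var gr_gen_anticommute[of 2])
  then have "?x = 0" by (rule gr_double_eq_0[OF assms])
  moreover have "gr_coeff ?x ({|2|} |\<union>| {|1|}) \<noteq> 0"
    unfolding gr_gen_def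
    by (subst gr_coeff_basis_mult) (auto simp: lookup_gr_basis gr_sign_def)
  ultimately show False by (simp add: lookup_gr_zero)
qed

text \<open>Identities are not central polynomials by definition, but an identity f is the
  difference of the central polynomials f + [x_1, x_2] and [x_1, x_2].\<close>

lemma CP_G0_eq_even_valued:
  assumes "CHAR('k::field) \<noteq> 2"
  shows "CP_G0 = (even_valued :: 'k free_alg set)"
proof
  have central: "central_poly_G0 f \<longleftrightarrow> f \<in> even_valued \<and> f \<notin> identities_G0"
    for f :: "'k free_alg"
    by (auto simp: central_poly_G0_def even_valued_eq[OF assms])
  then have sub: "{f. central_poly_G0 f} \<subseteq> (even_valued :: 'k free_alg set)" by blast
  with T_space_even_valued[where 'k = 'k] show "CP_G0 \<subseteq> (even_valued :: 'k free_alg set)"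
    unfolding CP_G0_def T_space_gen_def by blast
  let ?c = "commutator (var 1) (var 2) :: 'k free_alg"
  have c: "central_poly_G0 ?c"
    using commutator_not_identity[OF assms]
    by (simp add: central commutator_even_valued var_in_free_alg0)
  show "(even_valued :: 'k free_alg set) \<subseteq> CP_G0"
    unfolding CP_G0_def T_space_gen_def
  proof (intro subsetI InterI, elim CollectE conjE)
    fix f :: "'k free_alg" and V :: "'k free_alg set"
    assume f: "f \<in> even_valued" and V: "T_space free_scale free_alg0 V" "{f. central_poly_G0 f} \<subseteq> V"
    have sub: "free_vs.subspace V" using V(1) by (simp add: T_space_def)
    show "f \<in> V"
    proof (cases "f \<in> identities_G0")
      case True
      have "?c \<notin> identities_G0" using c central by blast
      then have "f + ?c \<notin> identities_G0"
        using free_vs.subspace_diff[OF subspace_identities_G0 _ True, of "f + ?c"] by auto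
      then have "central_poly_G0 (f + ?c)"
        using f c central free_vs.subspace_add[OF subspace_even_valued] by blast
      then have "f + ?c - ?c \<in> V"
        using V(2) c by (intro free_vs.subspace_diff[OF sub]) auto
      then show ?thesis by simp
    qed (use f V(2) central in blast)
  qed
qed

section \<open>Cyclic derivatives\<close>

abbreviation T_gen :: "'k::field free_alg set \<Rightarrow> 'k free_alg set" where
  "T_gen \<equiv> T_space_gen free_scale free_alg0"

lemma T_space_T_gen: "Y \<subseteq> free_alg0 \<Longrightarrow> T_space free_scale free_alg0 (T_gen Y)"
  by (rule T_space_T_space_gen[OF free_vs.module_axioms subalgebra_free_alg0])

lemma subspace_T_gen: "Y \<subseteq> free_alg0 \<Longrightarrow> free_vs.subspace (T_gen Y)"
  using T_space_T_gen unfolding T_space_def by blast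

lemma T_gen_eval:
  assumes "Y \<subseteq> free_alg0" "f \<in> Y" "range h \<subseteq> free_alg0"
  shows "eval free_scale h f \<in> T_gen Y"
proof -
  have "algebra_hom free_scale free_scale free_alg0 free_alg0 (eval free_scale h)"
    using assms(3) by (intro free.algebra_hom_eval[OF subalgebra_free_alg0]) blast
  moreover have "f \<in> T_gen Y"
    using assms(2) unfolding T_space_gen_def by blast
  ultimately show ?thesis
    using T_space_T_gen[OF assms(1)] unfolding T_space_def by blast
qed

lemma T_gen_minimal: "T_space free_scale free_alg0 V \<Longrightarrow> Y \<subseteq> V \<Longrightarrow> T_gen Y \<subseteq> V"
  unfolding T_space_gen_def by blast

abbreviation commutator_space :: "'k::field free_alg set" where
  "commutator_space \<equiv> T_gen {commutator (var 1) (var 2)}"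

lemma commutator_var_in_free_alg0: "{commutator (var 1) (var 2)} \<subseteq> free_alg0"
  by (simp add: commutator_in_free_alg0 var_in_free_alg0)

lemma commutator_in_commutator_space:
  assumes "f \<in> free_alg0" "h \<in> free_alg0"
  shows "commutator f h \<in> commutator_space"
proof -
  have "eval free_scale (\<lambda>i. if i = 1 then f else h) (commutator (var 1) (var 2)) \<in> commutator_space"
    by (rule T_gen_eval[OF commutator_var_in_free_alg0]) (use assms in auto)
  then show ?thesis
    by (simp add: free.eval_commutator free.eval_var del: One_nat_def)
qed

lemma commutator_space_subset_even_valued: "commutator_space \<subseteq> even_valued"
  by (rule T_gen_minimal[OF T_space_even_valued])
    (simp add: commutator_even_valued var_in_free_alg0)

lemma subspace_plus:
  "free_vs.subspace U \<Longrightarrow> free_vs.subspace V \<Longrightarrow> free_vs.subspace (U + V)"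
  using free_vs.subspace_sums[of U V] unfolding set_plus_def by (rule back_subst[of free_vs.subspace]) auto

section \<open>Occurrences of a letter, perturbation and the cyclic derivative\<close>

definition occs :: "nat \<Rightarrow> nat list \<Rightarrow> nat set" where
  "occs i xs = {j. j < length xs \<and> xs ! j = i}"

lemma occs_Nil: "occs i [] = {}"
  by (simp add: occs_def)

lemma occs_Cons: "occs i (x # xs) = (if x = i then {0} else {}) \<union> Suc ` occs i xs"
proof (rule set_eqI)
  show "j \<in> occs i (x # xs) \<longleftrightarrow> j \<in> (if x = i then {0} else {}) \<union> Suc ` occs i xs" for j
    by (cases j) (auto simp: occs_def)
qed

lemma finite_occs: "finite (occs i xs)"
  by (simp add: occs_def)

lemma card_occs: "card (occs i xs) = count_list xs i"
  by (simp add: occs_def count_list_eq_length_filter length_filter_conv_card eq_commute[of i])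

lemma sum_occs_Cons:
  "sum h (occs i (x # xs)) = (if x = i then h 0 else 0) + (\<Sum>j\<in>occs i xs. h (Suc j))"
  for h :: "nat \<Rightarrow> 'a::comm_monoid_add"
  unfolding occs_Cons
  by (subst sum.union_disjoint) (auto simp: finite_occs sum.reindex)

text \<open>Terms with two or more factors b contain some b x b, so the first-order expansion is
  exact.\<close>

lemma prod_list_perturb:
  fixes b :: "'a::ring_1"
  assumes b: "\<And>x. b * x * b = 0"
  shows "prod_list (map (g(i := g i + b)) xs) = prod_list (map g xs) +
    (\<Sum>j\<in>occs i xs. prod_list (map g (take j xs)) * b * prod_list (map g (drop (Suc j) xs)))"
proof (induction xs)
  case (Cons x xs)
  let ?L = "\<Sum>j\<in>occs i xs. prod_list (map g (take j xs)) * b * prod_list (map g (drop (Suc j) xs))"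
  have "b * ?L = 0"
    by (simp add: sum_distrib_left b flip: mult.assoc)
  then show ?case
    unfolding list.map prod_list.Cons Cons.IH sum_occs_Cons
    by (auto simp: distrib_left distrib_right sum_distrib_left sum.distrib mult.assoc)
qed (simp add: occs_Nil)

text \<open>The Euler operator in x_i; the degree is read in k, so it vanishes when divisible by the
  characteristic.\<close>

definition degree_op :: "nat \<Rightarrow> 'k::field free_alg \<Rightarrow> 'k free_alg" where
  "degree_op i f = Poly_Mapping.mapp (\<lambda>w c. of_nat (count_list (letters w) i) * c) f"

text \<open>Each occurrence in u x_i v contributes v u. The word x_i contributes the empty word, so
  the result may have a constant term.\<close>

definition cyclic_deriv :: "nat \<Rightarrow> 'k::field free_alg \<Rightarrow> 'k free_alg" where
  "cyclic_deriv i f = (\<Sum>w\<in>Poly_Mapping.keys f. free_scale (Poly_Mapping.lookup f w)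
     (\<Sum>j\<in>occs i (letters w).
        Poly_Mapping.single (Word (drop (Suc j) (letters w) @ take j (letters w))) 1))"

lemma lookup_degree_op:
  "Poly_Mapping.lookup (degree_op i f) w = of_nat (count_list (letters w) i) * Poly_Mapping.lookup f w"
  by (simp add: degree_op_def lookup_mapp when_def in_keys_iff)

text \<open>The multiplicity is spread over the occurrences, to be matched term by term with
  \<open>cyclic_deriv\<close>.\<close>

lemma degree_op_expansion:
  "degree_op i f = (\<Sum>w\<in>Poly_Mapping.keys f. free_scale (Poly_Mapping.lookup f w)
     (\<Sum>j\<in>occs i (letters w). Poly_Mapping.single w 1))"
proof (rule poly_mapping_eqI)
  fix v
  define K where "K w = (\<Sum>j\<in>occs i (letters w). Poly_Mapping.single w (1 :: 'a))" for w
  have K: "Poly_Mapping.lookup (K w) v =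
      (if w = v then of_nat (count_list (letters w) i) else 0)" for w
    unfolding K_def
    by (cases "w = v") (simp_all add: lookup_sum lookup_single when_def del: sum_constant,
        simp add: card_occs)
  show "Poly_Mapping.lookup (degree_op i f) v =
    Poly_Mapping.lookup (\<Sum>w\<in>Poly_Mapping.keys f. free_scale (Poly_Mapping.lookup f w)
     (\<Sum>j\<in>occs i (letters w). Poly_Mapping.single w 1)) v"
    unfolding K_def[symmetric]
    by (simp add: lookup_sum lookup_degree_op K in_keys_iff if_distrib cong: if_cong)
qed

lemma single_minus_rotate_in_commutator_space:
  "Poly_Mapping.single (Word (xs @ ys)) (1 :: 'k::field) - Poly_Mapping.single (Word (ys @ xs)) 1
    \<in> commutator_space"
proof (cases "xs = [] \<or> ys = []")
  case True
  then show ?thesis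
    using free_vs.subspace_0[OF subspace_T_gen[OF commutator_var_in_free_alg0]] by auto
next
  case False
  have "Poly_Mapping.single (Word (xs @ ys)) (1 :: 'k) - Poly_Mapping.single (Word (ys @ xs)) 1 =
      commutator (Poly_Mapping.single (Word xs) 1) (Poly_Mapping.single (Word ys) 1)"
    by (simp add: commutator_def mult_single plus_word_def)
  also have "\<dots> \<in> commutator_space"
    using False by (intro commutator_in_commutator_space single_in_free_alg0) auto
  finally show ?thesis .
qed

text \<open>At each occurrence u x_i v and x_i v u differ by a rotation, hence by a
  commutator.\<close>

lemma degree_op_cong_cyclic_deriv:
  "degree_op i f - var i * cyclic_deriv i f \<in> commutator_space"
proof -
  have "var i * cyclic_deriv i f =
      (\<Sum>w\<in>Poly_Mapping.keys f. free_scale (Poly_Mapping.lookup f w)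
       (\<Sum>j\<in>occs i (letters w).
          var i * Poly_Mapping.single (Word (drop (Suc j) (letters w) @ take j (letters w))) 1))"
    by (simp add: cyclic_deriv_def sum_distrib_left flip: free_scale_mult(2))
  \<comment> \<open>The letter at position j is x_i, and prefixing it to \<open>drop (Suc j)\<close>
    gives \<open>drop j\<close>.\<close>
  also have "\<dots> = (\<Sum>w\<in>Poly_Mapping.keys f. free_scale (Poly_Mapping.lookup f w)
       (\<Sum>j\<in>occs i (letters w).
          Poly_Mapping.single (Word (drop j (letters w) @ take j (letters w))) 1))"
    by (intro sum.cong refl arg_cong2[of _ _ _ _ free_scale])
      (auto simp: var_def mult_single plus_word_def occs_def simp flip: Cons_nth_drop_Suc)
  finally have "degree_op i f - var i * cyclic_deriv i f =
      (\<Sum>w\<in>Poly_Mapping.keys f. free_scale (Poly_Mapping.lookup f w)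
       (\<Sum>j\<in>occs i (letters w). Poly_Mapping.single (Word (take j (letters w) @ drop j (letters w))) 1 -
          Poly_Mapping.single (Word (drop j (letters w) @ take j (letters w))) 1))"
    by (simp add: degree_op_expansion sum_subtractf free_vs.scale_right_diff_distrib)
  also have "\<dots> \<in> commutator_space"
    by (intro free_vs.subspace_sum free_vs.subspace_scale single_minus_rotate_in_commutator_space
        subspace_T_gen commutator_var_in_free_alg0)
  finally show ?thesis .
qed

text \<open>Changing \<open>g i\<close> by a basis element b changes the value of f by a sum of
  terms L b R. Up to commutators of L and b R this is b times the value of the derivative, so that
  product is even for every b.\<close>

lemma gr_eval_cyclic_deriv:
  assumes f: "f \<in> even_valued" and g: "range g \<subseteq> grassmann0"
  shows "gr_eval g (cyclic_deriv i f) = 0"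
proof (rule gr_eq_0_if_basis_mult_even)
  fix B :: "nat fset" assume B: "B \<noteq> {||}"
  define b where "b = (gr_basis B :: 'a grassmann)"
  define g' where "g' = g(i := g i + b)"
  define L where "L = (\<lambda>w j. prod_list (map g (take j (letters w))))"
  define R where "R = (\<lambda>w j. prod_list (map g (drop (Suc j) (letters w))))"
  let ?S = "\<lambda>h. \<Sum>w\<in>Poly_Mapping.keys f. gr_scale (Poly_Mapping.lookup f w)
      (\<Sum>j\<in>occs i (letters w). h w j)"
  have "b \<in> grassmann0"
    using B by (simp add: b_def gr_basis_grassmann0)
  moreover have "g i \<in> grassmann0" using g by blast
  ultimately have "g i + b \<in> grassmann0"
    by (simp add: grassmann0_def lookup_gr_add)
  then have g': "range g' \<subseteq> grassmann0"
    using g by (auto simp: g'_def)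
  have "prod_list (map g' (letters w)) = prod_list (map g (letters w)) +
      (\<Sum>j\<in>occs i (letters w). L w j * b * R w j)" for w
    unfolding g'_def L_def R_def
    by (rule prod_list_perturb) (use B in \<open>simp add: b_def gr_basis_sandwich\<close>)
  then have diff: "gr_eval g' f - gr_eval g f = ?S (\<lambda>w j. L w j * b * R w j)"
    by (simp add: eval_def gr_vs.scale_right_distrib sum.distrib)
  have "b * gr_eval g (cyclic_deriv i f) = ?S (\<lambda>w j. b * (R w j * L w j))"
    by (simp add: cyclic_deriv_def gr.eval_sum gr.eval_scale gr.eval_single L_def R_def
        sum_distrib_left flip: gr_scale_mult(2))
  then have "b * gr_eval g (cyclic_deriv i f) =
      (gr_eval g' f - gr_eval g f) - ?S (\<lambda>w j. commutator (L w j) (b * R w j))"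
    unfolding diff
    by (simp add: commutator_def mult.assoc sum_subtractf gr_vs.scale_right_diff_distrib)
  also have "gr_parity True \<dots>"
    using f g g' by (intro gr_parity_minus gr_parity_sum gr_parity_scale gr_parity_commutator)
      (auto simp: even_valued_def)
  finally show "gr_parity True (gr_basis B * gr_eval g (cyclic_deriv i f))"
    by (simp add: b_def)
qed

lemma degree_op_even_valued:
  assumes "f \<in> even_valued"
  shows "degree_op i f \<in> commutator_space + identities_G0"
proof -
  have "degree_op i f \<in> free_alg0"
    using assms by (simp add: even_valued_def free_alg0_def lookup_degree_op)
  \<comment> \<open>Since the derivative may have a constant term, \<open>mult_in_free_alg0\<close>
    does not apply to its product with x_i; membership is obtained from the difference.\<close>
  moreover have "degree_op i f - var i * cyclic_deriv i f \<in> free_alg0"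
    using degree_op_cong_cyclic_deriv commutator_space_subset_even_valued
    unfolding even_valued_def by blast
  ultimately have "var i * cyclic_deriv i f \<in> free_alg0"
    using free_vs.subspace_diff[OF subspace_free_alg0] by fastforce
  then have "var i * cyclic_deriv i f \<in> identities_G0"
    by (simp add: identities_G0_eq gr.eval_mult gr_eval_cyclic_deriv[OF assms])
  from set_plus_intro[OF degree_op_cong_cyclic_deriv[of i f] this] show ?thesis by simp
qed

section \<open>Removing the words with a degree that is nonzero in k\<close>

lemma commutator_plus_identities_subset_even_valued:
  "commutator_space + identities_G0 \<subseteq> even_valued"
  using commutator_space_subset_even_valued identities_subset_even_valued
    free_vs.subspace_add[OF subspace_even_valued]
  by (auto elim!: set_plus_elim)

text \<open>The degree operator only rescales coefficients, so subtracting a multiple of it can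
  remove a chosen word without creating new ones. No Vandermonde argument, which would need many
  scalars, is involved.\<close>

lemma even_valued_reduction:
  fixes f :: "'k::field free_alg"
  assumes "f \<in> even_valued"
  shows "\<exists>h\<in>even_valued. f - h \<in> commutator_space + identities_G0 \<and>
    (\<forall>w\<in>Poly_Mapping.keys h. \<forall>i. of_nat (count_list (letters w) i) = (0 :: 'k))"
  using assms
proof (induction "card (Poly_Mapping.keys f)" arbitrary: f rule: less_induct)
  case less
  let ?V = "commutator_space + identities_G0 :: 'k free_alg set"
  have V: "free_vs.subspace ?V"
    by (intro subspace_plus subspace_T_gen commutator_var_in_free_alg0 subspace_identities_G0)
  show ?case
  proof (cases "\<forall>w\<in>Poly_Mapping.keys f. \<forall>i. of_nat (count_list (letters w) i) = (0 :: 'k)")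
    case True
    then show ?thesis
      using less.prems free_vs.subspace_0[OF V] by (intro bexI[of _ f]) auto
  next
    case False
    then obtain w i where w: "w \<in> Poly_Mapping.keys f" "of_nat (count_list (letters w) i) \<noteq> (0 :: 'k)"
      by blast
    \<comment> \<open>Normalised to have the same coefficient at w as f.\<close>
    define d where "d = free_scale (inverse (of_nat (count_list (letters w) i))) (degree_op i f)"
    have d: "d \<in> ?V"
      unfolding d_def by (intro free_vs.subspace_scale[OF V] degree_op_even_valued less.prems)
    have "Poly_Mapping.keys (f - d) \<subseteq> Poly_Mapping.keys f"
      by (auto simp: in_keys_iff lookup_minus d_def lookup_degree_op)
    moreover have "w \<notin> Poly_Mapping.keys (f - d)"
      using w(2) by (simp add: in_keys_iff lookup_minus d_def lookup_degree_op)
    ultimately have "card (Poly_Mapping.keys (f - d)) < card (Poly_Mapping.keys f)"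
      using w(1) by (intro psubset_card_mono) auto
    moreover have "f - d \<in> even_valued"
      using d commutator_plus_identities_subset_even_valued less.prems
      by (intro free_vs.subspace_diff[OF subspace_even_valued]) auto
    ultimately obtain h where h: "h \<in> even_valued" "f - d - h \<in> ?V"
        "\<forall>w\<in>Poly_Mapping.keys h. \<forall>i. of_nat (count_list (letters w) i) = (0 :: 'k)"
      using less.hyps by blast
    have "f - h = (f - d - h) + d" by simp
    also have "\<dots> \<in> ?V" by (intro free_vs.subspace_add[OF V] h d)
    finally show ?thesis using h by blast
  qed
qed

section \<open>Words in which the characteristic divides every multiplicity\<close>

text \<open>\<open>J\<close> marks the variables that contribute their odd part,
  \<open>\<beta>\<close> gives the exponents of the even parts, and \<open>L\<close> fixes the order
  of the variables.\<close>

definition gr_mon ::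
  "nat list \<Rightarrow> (nat \<Rightarrow> nat) \<Rightarrow> nat set \<Rightarrow> (nat \<Rightarrow> 'k::field grassmann) \<Rightarrow> 'k grassmann" where
  "gr_mon L \<beta> J g =
     prod_list (map (\<lambda>i. (if i \<in> J then gr_part False (g i) else 1) * gr_part True (g i) ^ \<beta> i) L)"

section \<open>Normal monomials under multiplication by even and odd parts\<close>

lemma gr_even_part_commute: "gr_part True x * y = y * gr_part True x"
  by (rule gr_even_commute[OF gr_parity_part])

lemma gr_even_part_left_commute: "gr_part True x * (z * y) = z * (gr_part True x * y)"
  by (simp only: mult.assoc[symmetric] gr_even_part_commute[of x z])

lemma gr_even_part_power_commute: "gr_part True x ^ n * y = y * gr_part True x ^ n"
  by (rule gr_even_commute[OF gr_parity_power[OF gr_parity_part]])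

lemma gr_odd_part_swap: "gr_part False x * gr_part False y = - (gr_part False y * gr_part False x)"
  by (rule gr_odd_anticommute[OF gr_parity_part gr_parity_part])

lemma gr_mon_Cons:
  "gr_mon (x # L) \<beta> J g =
     (if x \<in> J then gr_part False (g x) else 1) * gr_part True (g x) ^ \<beta> x * gr_mon L \<beta> J g"
  by (simp add: gr_mon_def)

lemma gr_mon_cong:
  "(\<And>i. i \<in> set L \<Longrightarrow> \<beta> i = \<beta>' i \<and> (i \<in> J \<longleftrightarrow> i \<in> J')) \<Longrightarrow> gr_mon L \<beta> J g = gr_mon L \<beta>' J' g"
  unfolding gr_mon_def by (intro arg_cong[of _ _ prod_list] map_cong) auto

lemma gr_mon_mult_even:
  assumes "distinct L" "l \<in> set L"
  shows "gr_part True (g l) * gr_mon L \<beta> J g = gr_mon L (\<beta>(l := Suc (\<beta> l))) J g"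
proof -
  define \<beta>' where "\<beta>' = \<beta>(l := Suc (\<beta> l))"
  have "gr_part True (g l) * gr_mon L \<beta> J g = gr_mon L \<beta>' J g"
    using assms
  proof (induction L)
    case (Cons x L)
    show ?case
    proof (cases "x = l")
      case True
      let ?q = "(if l \<in> J then gr_part False (g l) else 1)"
      have "gr_mon L \<beta>' J g = gr_mon L \<beta> J g"
        using Cons.prems True by (intro gr_mon_cong) (auto simp: \<beta>'_def)
      then have "gr_mon (l # L) \<beta>' J g =
          ?q * (gr_part True (g l) * gr_part True (g l) ^ \<beta> l) * gr_mon L \<beta> J g"
        by (simp add: gr_mon_Cons \<beta>'_def del: fun_upd_apply) (simp add: fun_upd_same)
      also have "\<dots> = gr_part True (g l) * gr_mon (l # L) \<beta> J g"
        by (simp only: gr_mon_Cons mult.assoc gr_even_part_left_commute[of _ ?q])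
      finally show ?thesis using True by simp
    next
      case False
      then have "gr_part True (g l) * gr_mon L \<beta> J g = gr_mon L \<beta>' J g"
        using Cons by simp
      moreover have "\<beta>' x = \<beta> x"
        using False by (simp add: \<beta>'_def)
      ultimately show ?thesis
        by (simp only: gr_mon_Cons gr_even_part_left_commute)
    qed
  qed simp
  then show ?thesis by (simp only: \<beta>'_def)
qed

text \<open>The factor moves, up to sign, to its own occurrence, where the square of an odd element
  vanishes.\<close>

lemma gr_mon_mult_odd_mem:
  fixes g :: "nat \<Rightarrow> 'k::field grassmann"
  assumes "CHAR('k) \<noteq> 2" "l \<in> set L" "l \<in> J"
  shows "gr_part False (g l) * gr_mon L \<beta> J g = 0"
  using assms(2)
proof (induction L)
  case (Cons x L)
  let ?d = "gr_part False (g l)"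
  let ?e = "gr_part True (g x) ^ \<beta> x"
  show ?case
  proof (cases "x = l")
    case True
    then show ?thesis
      using assms(1,3) gr_odd_square[OF assms(1) gr_parity_part]
      by (simp add: gr_mon_def flip: mult.assoc)
  next
    case False
    then have IH: "?d * gr_mon L \<beta> J g = 0" using Cons by simp
    have "?d * gr_mon (x # L) \<beta> J g =
        (if x \<in> J then - gr_part False (g x) else 1) * ?e * (?d * gr_mon L \<beta> J g)"
      using gr_even_part_power_commute[of "g x" "\<beta> x" ?d, symmetric] gr_odd_part_swap[of "g l" "g x"]
      by (simp add: gr_mon_def mult.assoc[symmetric]) (simp add: mult.assoc)
    then show ?thesis by (simp only: IH mult_zero_right)
  qed
qed simp

text \<open>Each odd factor passed contributes -1 and the even powers contribute nothing, so the
  sign depends on \<open>L\<close> and \<open>J\<close> and can be chosen before g.\<close>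

lemma gr_mon_mult_odd:
  assumes "distinct L" "l \<in> set L" "l \<notin> J"
  shows "\<exists>c. \<forall>g. gr_part False (g l) * gr_mon L \<beta> J g =
    gr_scale c (gr_mon L \<beta> (insert l J) g :: 'k::field grassmann)"
  using assms(1,2)
proof (induction L)
  case (Cons x L)
  show ?case
  proof (cases "x = l")
    case True
    have "gr_mon L \<beta> (insert l J) g = gr_mon L \<beta> J g" for g :: "nat \<Rightarrow> 'k grassmann"
      using Cons.prems True by (intro gr_mon_cong) auto
    then show ?thesis
      using True assms(3) by (intro exI[of _ 1]) (simp add: gr_mon_def mult.assoc)
  next
    case False
    then obtain c where c: "gr_part False (g l) * gr_mon L \<beta> J g =
        gr_scale c (gr_mon L \<beta> (insert l J) g)" for g :: "nat \<Rightarrow> 'k grassmann"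
      using Cons by auto
    have swap: "gr_part False (g l) * gr_mon (x # L) \<beta> J g =
        (if x \<in> J then - gr_part False (g x) else 1) * gr_part True (g x) ^ \<beta> x *
        (gr_part False (g l) * gr_mon L \<beta> J g)" for g :: "nat \<Rightarrow> 'k grassmann"
      using gr_even_part_power_commute[of "g x" "\<beta> x" "gr_part False (g l)", symmetric]
        gr_odd_part_swap[of "g l" "g x"]
      by (simp add: gr_mon_def mult.assoc[symmetric]) (simp add: mult.assoc)
    show ?thesis
      unfolding swap c
      by (intro exI[of _ "if x \<in> J then - c else c"])
        (use False in \<open>simp add: gr_mon_Cons mult.assoc gr_vs.scale_minus_left flip: gr_scale_mult\<close>)
  qed
qed simp

text \<open>
  Linear combinations of the \<open>gr_mon L \<beta> J\<close> of multidegree \<open>\<alpha>\<close>, as functions of the assignment: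
  the coefficients must not depend on \<open>g\<close>.
\<close>

inductive gr_mon_span ::
  "nat list \<Rightarrow> (nat \<Rightarrow> nat) \<Rightarrow> ((nat \<Rightarrow> 'k::field grassmann) \<Rightarrow> 'k grassmann) \<Rightarrow> bool"
  for L \<alpha> where
    zero: "gr_mon_span L \<alpha> (\<lambda>g. 0)"
  | add: "gr_mon_span L \<alpha> F \<Longrightarrow>
      (\<And>i. i \<in> set L \<Longrightarrow> \<beta> i + (if i \<in> J then 1 else 0) = \<alpha> i) \<Longrightarrow>
      gr_mon_span L \<alpha> (\<lambda>g. F g + gr_scale c (gr_mon L \<beta> J g))"

lemma gr_mon_span_add:
  assumes "gr_mon_span L \<alpha> F" "gr_mon_span L \<alpha> G"
  shows "gr_mon_span L \<alpha> (\<lambda>g. F g + G g)"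
  using assms(2)
proof induction
  case (add G \<beta> J c)
  then show ?case
    using gr_mon_span.add[OF add.IH add.hyps(2), of c] by (simp add: add.assoc)
qed (simp add: assms(1))

lemma gr_mon_span_mult_even:
  assumes "gr_mon_span L \<alpha> F" "distinct L" "l \<in> set L"
  shows "gr_mon_span L (\<alpha>(l := Suc (\<alpha> l))) (\<lambda>g. gr_part True (g l) * F g)"
  using assms(1)
proof induction
  case (add F \<beta> J c)
  have e: "(\<lambda>g. gr_part True (g l) * (F g + gr_scale c (gr_mon L \<beta> J g))) =
      (\<lambda>g. gr_part True (g l) * F g + gr_scale c (gr_mon L (\<beta>(l := Suc (\<beta> l))) J g))"
    by (simp add: distrib_left gr_mon_mult_even[OF assms(2,3)] flip: gr_scale_mult)
  show ?case
    unfolding e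
  proof (rule gr_mon_span.add[OF add.IH])
    fix i assume "i \<in> set L"
    from add.hyps(2)[OF this]
    show "(\<beta>(l := Suc (\<beta> l))) i + (if i \<in> J then 1 else 0) = (\<alpha>(l := Suc (\<alpha> l))) i"
      by auto
  qed
qed (simp add: gr_mon_span.zero)

lemma gr_mon_span_mult_odd:
  assumes "CHAR('k::field) \<noteq> 2"
  assumes "gr_mon_span L \<alpha> (F :: (nat \<Rightarrow> 'k grassmann) \<Rightarrow> _)" "distinct L" "l \<in> set L"
  shows "gr_mon_span L (\<alpha>(l := Suc (\<alpha> l))) (\<lambda>g. gr_part False (g l) * F g)"
  using assms(2)
proof induction
  case (add F \<beta> J c)
  show ?case
  proof (cases "l \<in> J")
    \<comment> \<open>The new term has a repeated odd factor and vanishes, so only the induction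
      hypothesis remains.\<close>
    case True
    then show ?thesis
      using add.IH
      by (simp add: distrib_left gr_mon_mult_odd_mem[OF assms(1,4)] flip: gr_scale_mult)
  next
    case False
    then obtain d where "gr_part False (g l) * gr_mon L \<beta> J g =
        gr_scale d (gr_mon L \<beta> (insert l J) g)" for g :: "nat \<Rightarrow> 'k grassmann"
      using gr_mon_mult_odd[OF assms(3,4)] by blast
    then have e: "(\<lambda>g. gr_part False (g l) * (F g + gr_scale c (gr_mon L \<beta> J g))) =
        (\<lambda>g. gr_part False (g l) * F g + gr_scale (c * d) (gr_mon L \<beta> (insert l J) g))"
      by (simp add: distrib_left flip: gr_scale_mult)
    show ?thesis
      unfolding e
    proof (rule gr_mon_span.add[OF add.IH])
      fix i assume "i \<in> set L"
      from add.hyps(2)[OF this] False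
      show "\<beta> i + (if i \<in> insert l J then 1 else 0) = (\<alpha>(l := Suc (\<alpha> l))) i"
        by auto
    qed
  qed
qed (simp add: gr_mon_span.zero)

text \<open>Each letter is split into its even and odd part; the empty word is the monomial with
  zero exponents and no odd factors.\<close>

lemma gr_mon_span_word:
  assumes "CHAR('k::field) \<noteq> 2" "distinct L" "set xs \<subseteq> set L"
  shows "gr_mon_span L (count_list xs) (\<lambda>g :: nat \<Rightarrow> 'k grassmann. prod_list (map g xs))"
  using assms(3)
proof (induction xs)
  case Nil
  have "gr_mon L (\<lambda>_. 0) {} g = 1" for g :: "nat \<Rightarrow> 'k grassmann"
    unfolding gr_mon_def by (induction L) auto
  then have e: "(\<lambda>g :: nat \<Rightarrow> 'k grassmann. prod_list (map g [])) =
      (\<lambda>g. 0 + gr_scale 1 (gr_mon L (\<lambda>_. 0) {} g))"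
    by simp
  show ?case
    unfolding e by (intro gr_mon_span.add gr_mon_span.zero) auto
next
  case (Cons x xs)
  have e: "(\<lambda>g :: nat \<Rightarrow> 'k grassmann. prod_list (map g (x # xs))) =
      (\<lambda>g. gr_part True (g x) * prod_list (map g xs) + gr_part False (g x) * prod_list (map g xs))"
    by (simp add: gr_part_add flip: distrib_right)
  have c: "count_list (x # xs) = (count_list xs)(x := Suc (count_list xs x))"
    by auto
  show ?case
    unfolding e c using Cons assms(2)
    by (intro gr_mon_span_add gr_mon_span_mult_even gr_mon_span_mult_odd[OF assms(1)]) auto
qed

section \<open>Collapse to a single top monomial when all degrees are at least p\<close>

definition gr_top :: "nat list \<Rightarrow> (nat \<Rightarrow> 'k::field grassmann) \<Rightarrow> 'k grassmann" where
  "gr_top L g = prod_list (map (\<lambda>i. gr_part False (g i) * gr_part True (g i) ^ (CHAR('k) - 1)) L)"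

lemma prod_list_eq_0: "0 \<in> set xs \<Longrightarrow> prod_list xs = (0 :: 'a::semiring_1)"
  by (induction xs) auto

text \<open>An even part with exponent at least p makes the monomial vanish. Otherwise the degree
  bound forces exponent p - 1 and an odd factor for each variable. The scalar does not depend on
  g.\<close>

lemma gr_mon_eq_gr_top:
  fixes g :: "nat \<Rightarrow> 'k::field grassmann"
  assumes p: "CHAR('k) \<noteq> 0" and g: "range g \<subseteq> grassmann0"
    and \<beta>: "\<And>i. i \<in> set L \<Longrightarrow> CHAR('k) \<le> \<beta> i + (if i \<in> J then 1 else 0)"
  shows "gr_mon L \<beta> J g = gr_scale (if \<exists>i\<in>set L. CHAR('k) \<le> \<beta> i then 0 else 1) (gr_top L g)"
proof (cases "\<exists>i\<in>set L. CHAR('k) \<le> \<beta> i")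
  case True
  then obtain i where i: "i \<in> set L" "CHAR('k) \<le> \<beta> i" by blast
  have "g i \<in> grassmann0" using g by blast
  then have "gr_part True (g i) ^ CHAR('k) = 0"
    by (intro gr_even_power_CHAR[OF p] gr_part_grassmann0 gr_parity_part)
  then have "gr_part True (g i) ^ \<beta> i = 0"
    using i(2) power_add[of "gr_part True (g i)" "CHAR('k)" "\<beta> i - CHAR('k)"] by simp
  then have "gr_mon L \<beta> J g = 0"
    unfolding gr_mon_def using i(1) by (intro prod_list_eq_0) force
  with True show ?thesis by simp
next
  case False
  have "i \<in> J \<and> \<beta> i = CHAR('k) - 1" if "i \<in> set L" for i
    using \<beta>[OF that] False that by (cases "i \<in> J") force+
  then have "gr_mon L \<beta> J g = gr_top L g"
    unfolding gr_mon_def gr_top_def by (intro arg_cong[of _ _ prod_list] map_cong) auto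
  with False show ?thesis by simp
qed

lemma gr_mon_span_top:
  assumes "CHAR('k::field) \<noteq> 0" "gr_mon_span L \<alpha> (F :: (nat \<Rightarrow> 'k grassmann) \<Rightarrow> _)"
    and "\<And>i. i \<in> set L \<Longrightarrow> CHAR('k) \<le> \<alpha> i"
  shows "\<exists>c. \<forall>g. range g \<subseteq> grassmann0 \<longrightarrow> F g = gr_scale c (gr_top L g)"
  using assms(2)
proof induction
  case (add F \<beta> J c)
  then obtain d where d: "range g \<subseteq> grassmann0 \<Longrightarrow> F g = gr_scale d (gr_top L g)" for g by blast
  let ?e = "if \<exists>i\<in>set L. CHAR('k) \<le> \<beta> i then 0 else 1 :: 'k"
  have "F g + gr_scale c (gr_mon L \<beta> J g) = gr_scale (d + c * ?e) (gr_top L g)"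
    if "range g \<subseteq> grassmann0" for g
  proof -
    have "gr_mon L \<beta> J g = gr_scale ?e (gr_top L g)"
      using that add.hyps(2) assms(3) by (intro gr_mon_eq_gr_top[OF assms(1)]) simp_all
    then show ?thesis
      using d[OF that] by (simp add: gr_vs.scale_left_distrib)
  qed
  then show ?case by blast
qed (auto intro: exI[of _ 0])

text \<open>A letter of the word has positive multiplicity divisible by p, hence at least p, so
  every normal monomial of the word collapses.\<close>

lemma gr_eval_word_top:
  assumes "CHAR('k::field) \<noteq> 0" "CHAR('k) \<noteq> 2"
    and "\<And>i. of_nat (count_list xs i) = (0 :: 'k)"
  shows "\<exists>c. \<forall>g. range g \<subseteq> grassmann0 \<longrightarrow>
    prod_list (map g xs) = gr_scale c (gr_top (remdups xs) g :: 'k grassmann)"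
proof (rule gr_mon_span_top[OF assms(1) gr_mon_span_word[OF assms(2)]])
  fix i assume "i \<in> set (remdups xs)"
  then have "count_list xs i \<noteq> 0" by (simp add: count_list_0_iff)
  moreover have "CHAR('k) dvd count_list xs i"
    using assms(3)[of i] by (simp add: of_nat_eq_0_iff_char_dvd)
  ultimately show "CHAR('k) \<le> count_list xs i" by (simp add: dvd_imp_le)
qed simp_all

lemma gr_parity_top: "gr_parity (even (length L)) (gr_top L g)"
proof (induction L)
  case (Cons x L)
  have "gr_parity False (gr_part False (g x) * gr_part True (g x) ^ (CHAR('a) - 1))"
    using gr_parity_mult[OF gr_parity_part gr_parity_power[OF gr_parity_part], of False "g x" "g x"]
    by simp
  from gr_parity_mult[OF this Cons.IH] show ?case
    by (simp add: gr_top_def)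
qed (simp add: gr_top_def gr_parity_one)

section \<open>Values of the polynomials w_n\<close>

lemma gr_odd_part_mult_power:
  fixes x :: "'k::field grassmann"
  assumes "CHAR('k) \<noteq> 2"
  shows "gr_part False x * x ^ n = gr_part False x * gr_part True x ^ n"
proof (induction n)
  case (Suc n)
  let ?d = "gr_part False x" and ?u = "gr_part True x"
  have "?d * x = ?d * ?u + ?d * ?d"
    by (metis distrib_left gr_part_add)
  then have dx: "?d * x = ?d * ?u"
    using gr_odd_square[OF assms gr_parity_part] by simp
  have "?d * x ^ Suc n = ?d * x ^ n * x"
    by (simp only: power_Suc2 mult.assoc)
  also have "\<dots> = ?u ^ n * (?d * x)"
    unfolding Suc by (simp only: gr_even_part_power_commute[of x n, symmetric] mult.assoc)
  also have "\<dots> = ?d * ?u ^ Suc n"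
    unfolding dx by (simp only: gr_even_part_power_commute[of x] power_Suc mult.assoc)
  finally show ?case .
qed simp

text \<open>The commutator is twice the product of the odd parts, and each odd part, having square
  zero, reduces the power of its own element to that of the even part.\<close>

lemma gr_commutator_mult_powers:
  fixes x y :: "'k::field grassmann"
  assumes "CHAR('k) \<noteq> 2"
  shows "commutator x y * x ^ n * y ^ n = gr_scale 2
    (gr_part False x * gr_part True x ^ n * (gr_part False y * gr_part True y ^ n))"
proof -
  let ?a = "gr_part False x" and ?b = "gr_part False y"
  \<comment> \<open>Swapping brings the odd part of x next to the power of x.\<close>
  have "?a * ?b * x ^ n = - (?b * (?a * x ^ n))"
    by (simp add: gr_odd_part_swap[of x y] mult.assoc)
  also have "\<dots> = ?a * ?b * gr_part True x ^ n"
    unfolding gr_odd_part_mult_power[OF assms] by (simp add: gr_odd_part_swap[of x y] mult.assoc)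
  also have "\<dots> = ?a * gr_part True x ^ n * ?b"
    by (simp only: gr_even_part_power_commute[of x n ?b] mult.assoc)
  finally have "?a * ?b * x ^ n * y ^ n = ?a * gr_part True x ^ n * (?b * y ^ n)"
    by (simp only: mult.assoc)
  then have "?a * ?b * x ^ n * y ^ n = ?a * gr_part True x ^ n * (?b * gr_part True y ^ n)"
    by (simp only: gr_odd_part_mult_power[OF assms])
  moreover have "gr_scale 2 z = z + z" for z :: "'k grassmann"
    using gr_vs.scale_left_distrib[of 1 1 z] by simp
  ultimately show ?thesis
    by (simp add: gr_commutator distrib_right)
qed

text \<open>Each of the n commutator blocks contributes a factor 2. In characteristic 0 the exponent
  \<open>CHAR('k) - 1\<close> truncates to 0 on both sides, so the formula covers that case
  too.\<close>

lemma gr_eval_w_poly: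
  assumes "CHAR('k::field) \<noteq> 2"
  shows "gr_eval g (w_poly n) = gr_scale (2 ^ n) (gr_top [1..<2 * n + 1] g :: 'k grassmann)"
proof (induction n)
  case (Suc n)
  have "[1..<Suc (Suc m)] = [1..<m] @ [m, Suc m]" if "1 \<le> m" for m
    using that by simp
  from this[of "2 * n + 1"] have "[1..<2 * Suc n + 1] = [1..<2 * n + 1] @ [2 * n + 1, 2 * n + 2]"
    by (simp del: upt_Suc)
  then have top: "gr_top [1..<2 * Suc n + 1] g = gr_top [1..<2 * n + 1] g *
      gr_top [2 * n + 1, 2 * n + 2] g"
    by (simp add: gr_top_def)
  have w: "w_poly (Suc n) = w_poly n * (commutator (var (2 * n + 1)) (var (2 * n + 2)) *
      var (2 * n + 1) ^ (CHAR('k) - 1) * var (2 * n + 2) ^ (CHAR('k) - 1) :: 'k free_alg)"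
    by (simp add: w_poly_def)
  show ?case
    unfolding w top gr.eval_mult gr.eval_power gr.eval_commutator gr.eval_var
      gr_commutator_mult_powers[OF assms] Suc.IH
    by (simp add: gr_top_def flip: gr_scale_mult)
qed (simp add: w_poly_def gr_top_def gr.eval_one)

text \<open>Used to substitute the letters of a word into w_n: its variables are numbered from 1,
  list positions from 0, hence k - 1.\<close>

lemma gr_top_reindex: "gr_top [1..<length L + 1] (\<lambda>k. g (L ! (k - 1))) = gr_top L g"
proof -
  have "map (\<lambda>k. L ! (k - 1)) [1..<length L + 1] = L"
    by (rule nth_equalityI) (simp_all add: nth_append del: upt_Suc)
  moreover have "gr_top [1..<length L + 1] (\<lambda>k. g (L ! (k - 1))) =
      gr_top (map (\<lambda>k. L ! (k - 1)) [1..<length L + 1]) g"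
    by (simp add: gr_top_def comp_def del: upt_Suc)
  ultimately show ?thesis by (simp only:)
qed

section \<open>Words with multiplicities divisible by p, modulo the T-space of the w_n\<close>

abbreviation w_space :: "'k::field free_alg set" where
  "w_space \<equiv> T_gen {w_poly n | n. n \<ge> 1}"

lemma mult_power_in_free_alg0:
  "f \<in> free_alg0 \<Longrightarrow> h \<in> free_alg0 \<Longrightarrow> f * h ^ n \<in> free_alg0"
  by (induction n) (simp_all add: mult_in_free_alg0 power_Suc2 flip: mult.assoc del: power_Suc)

lemma w_poly_in_free_alg0: "n \<ge> 1 \<Longrightarrow> w_poly n \<in> free_alg0"
  unfolding w_poly_def
  by (rule free.prod_list_closed[OF subalgebra_free_alg0])
    (auto intro!: mult_power_in_free_alg0 commutator_in_free_alg0 var_in_free_alg0)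

lemma w_polys_in_free_alg0: "{w_poly n | n. n \<ge> 1} \<subseteq> free_alg0"
  using w_poly_in_free_alg0 by blast

lemma w_space_subset_even_valued:
  assumes "CHAR('k::field) \<noteq> 2"
  shows "(w_space :: 'k free_alg set) \<subseteq> even_valued"
proof (rule T_gen_minimal[OF T_space_even_valued], safe)
  fix n :: nat assume "n \<ge> 1"
  moreover have "gr_parity True (gr_eval g (w_poly n))" for g :: "nat \<Rightarrow> 'k grassmann"
    using gr_parity_top[of "[1..<2 * n + 1]" g]
    by (simp add: gr_eval_w_poly[OF assms] gr_parity_scale del: upt_Suc)
  ultimately show "w_poly n \<in> (even_valued :: 'k free_alg set)"
    by (simp add: even_valued_def w_poly_in_free_alg0)
qed

text \<open>The word and w_n at its distinct letters both take multiples of the same top monomial as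
  values, with constants c and 2^n.\<close>

lemma word_in_w_space:
  assumes "CHAR('k::field) \<noteq> 0" "CHAR('k) \<noteq> 2"
    and "\<And>i. of_nat (count_list xs i) = (0 :: 'k)"
    and "xs \<noteq> []" "even (length (remdups xs))"
  shows "Poly_Mapping.single (Word xs) (1 :: 'k) \<in> w_space + identities_G0"
proof -
  define L where "L = remdups xs"
  obtain n where n: "length L = 2 * n" using assms(5) by (auto simp: L_def)
  have "L \<noteq> []" using assms(4) by (simp add: L_def)
  then have n1: "n \<ge> 1" using n by (cases n) auto
  obtain c where c: "range g \<subseteq> grassmann0 \<Longrightarrow> prod_list (map g xs) = gr_scale c (gr_top L g)"
    for g :: "nat \<Rightarrow> 'k grassmann"
    using gr_eval_word_top[OF assms(1-3)] unfolding L_def by blast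
  have two: "(2 :: 'k) \<noteq> 0"
    by (rule two_neq_0_if_CHAR[OF assms(2)])
  define W where "W = eval free_scale (\<lambda>k. var (L ! (k - 1))) (w_poly n :: 'k free_alg)"
  have W: "W \<in> w_space"
    unfolding W_def using n1
    by (intro T_gen_eval[OF w_polys_in_free_alg0]) (auto intro: var_in_free_alg0)
  \<comment> \<open>Dividing by 2^n gives S the same values as the word on G_0.\<close>
  define S where "S = free_scale (c / 2 ^ n) W"
  have S: "S \<in> w_space"
    unfolding S_def by (rule free_vs.subspace_scale[OF subspace_T_gen[OF w_polys_in_free_alg0] W])
  have "gr_eval g (Poly_Mapping.single (Word xs) 1 - S) = 0" if "range g \<subseteq> grassmann0" for g
  proof -
    have "gr_eval g W = gr_scale (2 ^ n) (gr_top L g)"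
      using gr_top_reindex[of L g] n
      by (simp add: W_def gr.eval_eval gr.eval_var gr_eval_w_poly[OF assms(2)])
    then show ?thesis
      using two by (simp add: S_def gr.eval_diff gr.eval_scale gr.eval_single c[OF that])
  qed
  moreover have "Poly_Mapping.single (Word xs) 1 - S \<in> free_alg0"
    using S w_space_subset_even_valued[OF assms(2)] assms(4)
    by (intro free_vs.subspace_diff[OF subspace_free_alg0] single_in_free_alg0)
      (auto simp: even_valued_def)
  ultimately have "Poly_Mapping.single (Word xs) 1 - S \<in> identities_G0"
    by (simp add: identities_G0_eq)
  from set_plus_intro[OF S this] show ?thesis by simp
qed

text \<open>Words with an even number of distinct letters are handled by
  \<open>word_in_w_space\<close>. The sum of the others has even values, as a difference of
  even-valued polynomials, and odd values word by word, so it is an identity.\<close>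

lemma even_valued_char_multiplicities:
  fixes f :: "'k::field free_alg"
  assumes p: "CHAR('k) \<noteq> 0" "CHAR('k) \<noteq> 2" and f: "f \<in> even_valued"
    and mult: "\<And>w i. w \<in> Poly_Mapping.keys f \<Longrightarrow> of_nat (count_list (letters w) i) = (0 :: 'k)"
  shows "f \<in> w_space + identities_G0"
proof -
  let ?V = "w_space + identities_G0 :: 'k free_alg set"
  have V: "free_vs.subspace ?V"
    by (intro subspace_plus subspace_T_gen w_polys_in_free_alg0 subspace_identities_G0)
  have f0: "f \<in> free_alg0" using f by (simp add: even_valued_def)
  let ?t = "\<lambda>w. free_scale (Poly_Mapping.lookup f w) (Poly_Mapping.single w 1)"
  let ?E = "{w \<in> Poly_Mapping.keys f. even (length (remdups (letters w)))}"
  let ?O = "{w \<in> Poly_Mapping.keys f. odd (length (remdups (letters w)))}"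
  have "sum ?t ?E \<in> ?V"
  proof (intro free_vs.subspace_sum[OF V] free_vs.subspace_scale[OF V])
    fix w assume w: "w \<in> ?E"
    then have "Poly_Mapping.single (Word (letters w)) 1 \<in> ?V"
      using mult keys_free_alg0[OF f0, of w] by (intro word_in_w_space p) (auto, metis word.collapse)
    then show "Poly_Mapping.single w 1 \<in> ?V" by simp
  qed
  moreover have split: "f = sum ?t ?E + sum ?t ?O"
  proof -
    have "sum ?t (?E \<union> ?O) = sum ?t ?E + sum ?t ?O"
      by (rule sum.union_disjoint) auto
    moreover have "?E \<union> ?O = Poly_Mapping.keys f" by auto
    ultimately have "sum ?t (Poly_Mapping.keys f) = sum ?t ?E + sum ?t ?O" by (simp only:)
    then show ?thesis by (simp flip: free_alg_expansion)
  qed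
  moreover have "sum ?t ?O \<in> identities_G0"
  proof -
    have "?V \<subseteq> even_valued"
      using w_space_subset_even_valued[OF p(2)] identities_subset_even_valued
        free_vs.subspace_add[OF subspace_even_valued]
      by (auto elim!: set_plus_elim)
    then have O: "sum ?t ?O \<in> even_valued"
      using free_vs.subspace_diff[OF subspace_even_valued f, of "sum ?t ?E"] \<open>sum ?t ?E \<in> ?V\<close> split
      by (metis (no_types, lifting) add_diff_cancel_left' subsetD)
    have "gr_eval g (sum ?t ?O) = 0" if g: "range g \<subseteq> grassmann0" for g
    proof (rule gr_parity_both_zero)
      show "gr_parity True (gr_eval g (sum ?t ?O))"
        using O g by (simp add: even_valued_def)
      show "gr_parity False (gr_eval g (sum ?t ?O))"
        unfolding gr.eval_sum gr.eval_scale gr.eval_single gr_vs.scale_one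
      proof (intro gr_parity_sum gr_parity_scale)
        fix w assume w: "w \<in> ?O"
        then have "\<exists>c. \<forall>g. range g \<subseteq> grassmann0 \<longrightarrow> prod_list (map g (letters w)) =
            gr_scale c (gr_top (remdups (letters w)) g :: 'k grassmann)"
          using mult by (intro gr_eval_word_top p) simp
        then obtain c where
          "prod_list (map g (letters w)) = gr_scale c (gr_top (remdups (letters w)) g)"
          using g by blast
        then show "gr_parity False (prod_list (map g (letters w)))"
          using w gr_parity_top[of "remdups (letters w)" g] by (simp add: gr_parity_scale)
      qed
    qed
    then show ?thesis using O by (simp add: identities_G0_eq even_valued_def)
  qed
  moreover have "identities_G0 \<subseteq> ?V"
  proof
    fix x :: "'k free_alg" assume "x \<in> identities_G0"
    from set_plus_intro[OF free_vs.subspace_0[OF subspace_T_gen[OF w_polys_in_free_alg0]] this]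
    show "x \<in> ?V" by simp
  qed
  ultimately have "sum ?t ?E + sum ?t ?O \<in> ?V"
    by (intro free_vs.subspace_add[OF V]) auto
  with split show ?thesis by (simp only:)
qed

text \<open>In characteristic 0 only the empty word has all multiplicities zero, and
  \<open>free_alg0\<close> excludes it.\<close>

lemma char0_multiplicities:
  fixes f :: "'k::field free_alg"
  assumes "CHAR('k) = 0" "f \<in> free_alg0"
    and "\<And>w i. w \<in> Poly_Mapping.keys f \<Longrightarrow> of_nat (count_list (letters w) i) = (0 :: 'k)"
  shows "f = 0"
proof -
  have False if w: "w \<in> Poly_Mapping.keys f" for w
  proof -
    have "count_list (letters w) i = 0" for i
      using assms(1) assms(3)[of w i] w by (simp add: of_nat_eq_0_iff_char_dvd)
    then have "letters w = []"
      by (metis count_list_0_iff list.set_intros(1) neq_Nil_conv)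
    then show False
      using keys_free_alg0[OF assms(2) w] by (metis word.collapse)
  qed
  then show ?thesis
    by (metis keys_eq_empty equals0I)
qed

theorem theorem2p1:
  assumes "CHAR('k::field) \<noteq> 2"
  shows "(CP_G0 :: 'k free_alg set) = S_space + identities_G0"
  unfolding CP_G0_eq_even_valued[OF assms]
proof (intro subset_antisym subsetI)
  fix f :: "'k free_alg"
  assume f: "f \<in> even_valued"
  obtain h where h: "h \<in> even_valued" "f - h \<in> commutator_space + identities_G0"
      "\<And>w i. w \<in> Poly_Mapping.keys h \<Longrightarrow> of_nat (count_list (letters w) i) = (0 :: 'k)"
    using even_valued_reduction[OF f] by blast
  show "f \<in> S_space + identities_G0"
  proof (cases "CHAR('k) = 0")
    case True
    have "h = 0"
      using h by (intro char0_multiplicities True) (auto simp: even_valued_def)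
    then show ?thesis
      using h(2) True by (simp add: S_space_def)
  next
    case False
    then have "h \<in> w_space + identities_G0"
      using h by (intro even_valued_char_multiplicities assms)
    \<comment> \<open>Both f - h and h are known modulo identities; the two copies of the identities
      merge into one.\<close>
    with h(2) have "(f - h) + h \<in> (commutator_space + identities_G0) + (w_space + identities_G0)"
      by (intro set_plus_intro)
    moreover have "(commutator_space + identities_G0) + (w_space + identities_G0) =
        (commutator_space + w_space) + (identities_G0 + identities_G0 :: 'k free_alg set)"
      by (simp only: ac_simps)
    moreover have "identities_G0 + identities_G0 \<subseteq> (identities_G0 :: 'k free_alg set)"
      using free_vs.subspace_add[OF subspace_identities_G0] by (auto elim!: set_plus_elim)
    moreover have "(commutator_space + w_space) + (identities_G0 + identities_G0) \<subseteq>
        (commutator_space + w_space) + (identities_G0 :: 'k free_alg set)"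
      if "identities_G0 + identities_G0 \<subseteq> (identities_G0 :: 'k free_alg set)"
      using that by (rule set_plus_mono2[OF subset_refl])
    ultimately have "f \<in> (commutator_space + w_space) + identities_G0"
      by auto
    then show ?thesis
      using False by (simp only: S_space_def if_False)
  qed
next
  fix f :: "'k free_alg"
  \<comment> \<open>For the converse it suffices that the summands of S consist of even-valued
    polynomials.\<close>
  have "S_space \<subseteq> (even_valued :: 'k free_alg set)"
    using commutator_space_subset_even_valued w_space_subset_even_valued[OF assms]
      free_vs.subspace_add[OF subspace_even_valued]
    unfolding S_space_def by (auto elim!: set_plus_elim)
  moreover assume "f \<in> S_space + identities_G0"
  ultimately show "f \<in> even_valued"
    using identities_subset_even_valued free_vs.subspace_add[OF subspace_even_valued]
    by (auto elim!: set_plus_elim)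
qed

end
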